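(* Let $\Sigma$ be a Riemann surface and $X$ any non-zero meromorphic vector field on $\Sigma$. Let $\mathfrak{RD}$ be the field of rational differential operators on $\Sigma$, $\mathfrak{RD}^{\mathrm{inv}}$ its subalgebra of $\mathrm{PGL}_2\mathbb{C}$-invariant operators, and $\mathfrak{RD}_{\mathrm{eq}}$ the monoid of $\mathrm{PGL}_2\mathbb{C}$-equivariant rational operators. Put $\varphi_X=-\tfrac12X_2/X_1$, i.e. $\varphi_X(f)=-\tfrac12\ddot f/\dot f$ with $\dot f=X(f)$. Then the map $$\mathcal{H}\;\mapsto\;\Phi_X\mathcal{H}=\mathrm{Id}+X/(\mathcal{H}+\varphi_X)$$ maps $\mathfrak{RD}^{\mathrm{inv}}$ to $\mathfrak{RD}_{\mathrm{eq}}-\{\mathrm{Id}\}$ bijectively.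
   Context: Let $\mathfrak{M}$ be the field of meromorphic functions on the (connected) Riemann surface $\Sigma$. Write $X_0=\mathrm{Id}$, $X_1=X$, and $X_k=X\circ\cdots\circ X$ ($k$ times), so $X_k(f)=f^{(k)}$ with respect to the derivation $X$. The field of rational differential operators is $\mathfrak{RD}=\mathfrak{M}(X_0,X_1,X_2,\dots)$, the fraction field of the polynomial ring $\mathfrak{M}[X_0,X_1,\dots]$ in infinitely many variables, with pointwise multiplication ($(X_iX_j)(f)=X_i(f)X_j(f)$); it does not depend on the choice of $X$. An element $\mathcal{R}\in\mathfrak{RD}$ acts on those $f\in\mathfrak{M}$ at which its denominator does not vanish identically. Composition $\mathcal{R}\circ\mathcal{Q}$ is composition of operators: it is obtained from $\mathcal{R}$ by substituting $D^k\mathcal{Q}$ for $X_k$, where $D$ is the derivation of $\mathfrak{RD}$ extending $X$ on $\mathfrak{M}$ with $D X_k=X_{k+1}$. A Möbius transformation $T=\begin{bmatrix}a&b\\c&d\end{bmatrix}\in\mathrm{PGL}_2\mathbb{C}$ is identified with the operator $(aX_0+b)/(cX_0+d)\in\mathfrak{RD}$. Then $\mathcal{R}$ is invariant ($\mathcal{R}\in\mathfrak{RD}^{\mathrm{inv}}$) if $\mathcal{R}\circ T=\mathcal{R}$ for all $T\in\mathrm{PGL}_2\mathbb{C}$, and equivariant ($\mathcal{R}\in\mathfrak{RD}_{\mathrm{eq}}$) if $\mathcal{R}\circ T=T\circ\mathcal{R}$ for all $T\in\mathrm{PGL}_2\mathbb{C}$. *)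

theory Defs
  imports
    "HOL-Complex_Analysis.Complex_Analysis"
    "HOL-Computational_Algebra.Fraction_Field"
    "HOL-Library.Poly_Mapping"
begin

section \<open>Riemann surfaces and their meromorphic functions\<close>

text \<open>A chart is a pair \<open>(U, \<phi>)\<close>; only the values of \<open>\<phi>\<close> on \<open>U\<close> matter.  The axioms \<open>chart_inj\<close>,
  \<open>chart_open\<close> and \<open>chart_open_iff\<close> say that \<open>\<phi>\<close> is a homeomorphism from the open set \<open>U\<close>
  onto an open set (lemma \<open>chart_homeomorphism\<close>): \<^const>\<open>continuous_on\<close> is not available
  inside a class specification.\<close>

class riemann_surface = t2_space +
  fixes atlas :: "('a set \<times> ('a \<Rightarrow> complex)) set"
  assumes connected_surface: "connected (UNIV :: 'a set)"
    and chart_cover: "(\<Union>(U, \<phi>)\<in>atlas. U) = UNIV"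
    and chart_inj: "(U, \<phi>) \<in> atlas \<Longrightarrow> inj_on \<phi> U"
    and chart_open: "(U, \<phi>) \<in> atlas \<Longrightarrow> open U"
    and chart_open_iff: "(U, \<phi>) \<in> atlas \<Longrightarrow> W \<subseteq> U \<Longrightarrow> open (\<phi> ` W) \<longleftrightarrow> open W"
    and chart_transition: "(U, \<phi>) \<in> atlas \<Longrightarrow> (V, \<psi>) \<in> atlas \<Longrightarrow>
      (\<psi> \<circ> inv_into U \<phi>) holomorphic_on \<phi> ` (U \<inter> V)"

lemma chart_homeomorphism:
  assumes c: "(U, \<phi>) \<in> atlas"
  shows "open U" "open (\<phi> ` U)" "homeomorphism U (\<phi> ` U) \<phi> (inv_into U \<phi>)"
proof -
  note inj = chart_inj[OF c]
  show U: "open U" by (rule chart_open[OF c])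
  show \<phi>U: "open (\<phi> ` U)" using chart_open_iff[OF c order_refl] U by simp
  show "homeomorphism U (\<phi> ` U) \<phi> (inv_into U \<phi>)"
  proof
    show "continuous_on U \<phi>"
      unfolding continuous_on_open_vimage[OF U]
    proof safe
      fix B :: "complex set" assume "open B"
      then have "open (B \<inter> \<phi> ` U)" using \<phi>U by (rule open_Int)
      also have "B \<inter> \<phi> ` U = \<phi> ` (\<phi> -` B \<inter> U)" by auto
      finally show "open (\<phi> -` B \<inter> U)" by (simp add: chart_open_iff[OF c])
    qed
    show "continuous_on (\<phi> ` U) (inv_into U \<phi>)"
      unfolding continuous_on_open_vimage[OF \<phi>U]
    proof safe
      fix B :: "'a set" assume "open B"
      then have "open (B \<inter> U)" using U by (rule open_Int)
      then have "open (\<phi> ` (B \<inter> U))" by (simp add: chart_open_iff[OF c])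
      also have "\<phi> ` (B \<inter> U) = inv_into U \<phi> -` B \<inter> \<phi> ` U"
        using inj by (auto simp: inv_into_f_f)
      finally show "open (inv_into U \<phi> -` B \<inter> \<phi> ` U)" .
    qed
  qed (use inj in \<open>auto simp: inv_into_f_f f_inv_into_f\<close>)
qed

definition surface_meromorphic :: "('a::riemann_surface \<Rightarrow> complex) \<Rightarrow> bool" where
  "surface_meromorphic f \<longleftrightarrow> (\<forall>(U, \<phi>)\<in>atlas. (f \<circ> inv_into U \<phi>) meromorphic_on \<phi> ` U)"

text \<open>The library predicate \<^term>\<open>f meromorphic_on A\<close> leaves the values of \<open>f\<close> on a sparse set
  arbitrary, so a meromorphic function is a class of such \<open>f\<close> modulo sparse sets.\<close>

definition mero_eq :: "('a::riemann_surface \<Rightarrow> complex) \<Rightarrow> ('a \<Rightarrow> complex) \<Rightarrow> bool" where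
  "mero_eq f g \<longleftrightarrow> surface_meromorphic f \<and> surface_meromorphic g \<and>
     eventually (\<lambda>x. f x = g x) (cosparse UNIV)"

lemma mero_eq_iff:
  "mero_eq f g \<longleftrightarrow> surface_meromorphic f \<and> surface_meromorphic g \<and>
     (\<forall>x. eventually (\<lambda>y. f y = g y) (at x))"
  unfolding mero_eq_def eventually_cosparse_open_eq[OF open_UNIV] by simp

lemma surface_meromorphic_const: "surface_meromorphic (\<lambda>_. c)"
  by (auto simp: surface_meromorphic_def o_def intro!: meromorphic_intros)

quotient_type (overloaded) 'a mero = "'a::riemann_surface \<Rightarrow> complex" / partial: mero_eq
proof (rule part_equivpI)
  show "\<exists>f. mero_eq f f"
    by (rule exI[of _ "\<lambda>_. 0"]) (auto simp: mero_eq_iff surface_meromorphic_const)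
  show "symp mero_eq" by (auto simp: symp_def mero_eq_iff eq_commute)
  show "transp mero_eq"
    unfolding transp_def mero_eq_def
    by (intro allI impI conjI; (elim conjE)?; (assumption | erule (1) eventually_elim2; simp))
qed

lemma chartD:
  assumes "(U, \<phi>) \<in> atlas"
  shows "open U" "open (\<phi> ` U)" "continuous_on U \<phi>" "continuous_on (\<phi> ` U) (inv_into U \<phi>)"
    "inj_on \<phi> U" "\<And>x. x \<in> U \<Longrightarrow> inv_into U \<phi> (\<phi> x) = x"
  using chart_homeomorphism(1,2)[OF assms] chart_inj[OF assms]
    homeomorphism_cont1[OF chart_homeomorphism(3)[OF assms]]
    homeomorphism_cont2[OF chart_homeomorphism(3)[OF assms]]
  by simp_all

lemma chart_exists: obtains U \<phi> where "(U, \<phi>) \<in> atlas" "x \<in> U"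
proof -
  have "x \<in> (\<Union>(U, \<phi>)\<in>atlas. U)" by (simp only: chart_cover UNIV_I)
  then show thesis using that by auto
qed

lemma chart_at:
  assumes "(U, \<phi>) \<in> atlas" "x \<in> U"
  shows "filtermap \<phi> (at x) = at (\<phi> x)" "filtermap (inv_into U \<phi>) (at (\<phi> x)) = at x"
proof -
  note c = chartD[OF assms(1)]
  show "filtermap (inv_into U \<phi>) (at (\<phi> x)) = at x"
  proof (rule filter_eqI)
    fix P
    show "eventually P (filtermap (inv_into U \<phi>) (at (\<phi> x))) \<longleftrightarrow> eventually P (at x)"
      unfolding eventually_filtermap
    proof
      assume "\<forall>\<^sub>F z in at (\<phi> x). P (inv_into U \<phi> z)"
      then obtain T where T: "open T" "\<phi> x \<in> T" "\<And>z. z \<in> T \<Longrightarrow> z \<noteq> \<phi> x \<Longrightarrow> P (inv_into U \<phi> z)"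
        by (auto simp: eventually_at_topological)
      have "open (U \<inter> \<phi> -` T)" by (rule continuous_open_preimage[OF c(3) c(1) T(1)])
      moreover have "P y" if "y \<in> U \<inter> \<phi> -` T" "y \<noteq> x" for y
        using T(3)[of "\<phi> y"] that assms(2) c(5,6) by (auto simp: inj_on_def)
      ultimately show "eventually P (at x)"
        unfolding eventually_at_topological using assms(2) T(2)
        by (intro exI[of _ "U \<inter> \<phi> -` T"]) auto
    next
      assume "eventually P (at x)"
      then obtain S where S: "open S" "x \<in> S" "\<And>y. y \<in> S \<Longrightarrow> y \<noteq> x \<Longrightarrow> P y"
        by (auto simp: eventually_at_topological)
      have "open (\<phi> ` U \<inter> inv_into U \<phi> -` S)"
        by (rule continuous_open_preimage[OF c(4) c(2) S(1)])
      moreover have "P (inv_into U \<phi> z)" if "z \<in> \<phi> ` U \<inter> inv_into U \<phi> -` S" "z \<noteq> \<phi> x" for z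
        using S(3)[of "inv_into U \<phi> z"] that f_inv_into_f[of z \<phi> U] by fastforce
      ultimately show "\<forall>\<^sub>F z in at (\<phi> x). P (inv_into U \<phi> z)"
        unfolding eventually_at_topological using assms(2) S(2) c(6)
        by (intro exI[of _ "\<phi> ` U \<inter> inv_into U \<phi> -` S"]) auto
    qed
  qed
  have "filtermap \<phi> (at x) = filtermap \<phi> (filtermap (inv_into U \<phi>) (at (\<phi> x)))"
    using \<open>filtermap (inv_into U \<phi>) (at (\<phi> x)) = at x\<close> by simp
  also have "\<dots> = filtermap (\<lambda>z. z) (at (\<phi> x))"
    unfolding filtermap_filtermap
  proof (rule filter_eqI, unfold eventually_filtermap)
    fix P
    have "\<phi> x \<in> \<phi> ` U" using assms(2) by simp
    then have "\<forall>\<^sub>F z in at (\<phi> x). z \<in> \<phi> ` U" by (rule eventually_at_in_open'[OF c(2)])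
    then have "\<forall>\<^sub>F z in at (\<phi> x). P (\<phi> (inv_into U \<phi> z)) \<longleftrightarrow> P z"
      by (rule eventually_mono) (simp add: f_inv_into_f)
    then show "(\<forall>\<^sub>F z in at (\<phi> x). P (\<phi> (inv_into U \<phi> z))) \<longleftrightarrow> (\<forall>\<^sub>F z in at (\<phi> x). P z)"
      by (rule eventually_subst)
  qed
  finally show "filtermap \<phi> (at x) = at (\<phi> x)" by simp
qed

lemma eventually_at_chart:
  assumes "(U, \<phi>) \<in> atlas" "x \<in> U"
  shows "eventually P (at x) \<longleftrightarrow> (\<forall>\<^sub>F z in at (\<phi> x). P (inv_into U \<phi> z))"
  by (subst chart_at(2)[OF assms, symmetric]) (rule eventually_filtermap)

instance riemann_surface \<subseteq> perfect_space
proof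
  fix x :: 'a
  obtain U \<phi> where c: "(U, \<phi>) \<in> atlas" "x \<in> U" by (rule chart_exists)
  show "\<not> open {x}"
  proof
    assume "open {x}"
    then have "eventually (\<lambda>_. False) (at x)" by (auto simp: eventually_at_topological)
    then show False by (simp add: eventually_at_chart[OF c])
  qed
qed

lemma surface_meromorphic_zero_or_nonzero:
  assumes "surface_meromorphic f"
  shows "(\<forall>x. \<forall>\<^sub>F y in at x. f y = 0) \<or> (\<forall>x. \<forall>\<^sub>F y in at x. f y \<noteq> 0)"
proof -
  define Z where "Z = {x. \<forall>\<^sub>F y in at x. f y = 0}"
  define N where "N = {x. \<forall>\<^sub>F y in at x. f y \<noteq> 0}"
  have opn: "open {x. eventually P (at x)}" for P :: "'a \<Rightarrow> bool"
  proof (subst open_subopen, safe)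
    fix x assume "eventually P (at x)"
    then obtain S where S: "open S" "x \<in> S" "\<And>y. y \<in> S \<Longrightarrow> y \<noteq> x \<Longrightarrow> P y"
      by (auto simp: eventually_at_topological)
    have "eventually P (at y)" if "y \<in> S" for y
    proof (cases "y = x")
      case True
      then show ?thesis using \<open>eventually P (at x)\<close> by simp
    next
      case False
      have "open (S - {x})" using S(1) by auto
      then show ?thesis
        unfolding eventually_at_topological using S(3) that False
        by (intro exI[of _ "S - {x}"]) auto
    qed
    then show "\<exists>T. open T \<and> x \<in> T \<and> T \<subseteq> {x. eventually P (at x)}" using S(1,2) by blast
  qed
  have "Z \<union> N = UNIV"
  proof safe
    fix x assume "x \<notin> N"
    obtain U \<phi> where c: "(U, \<phi>) \<in> atlas" "x \<in> U" by (rule chart_exists)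
    have "(f \<circ> inv_into U \<phi>) meromorphic_on {\<phi> x}"
      using assms c unfolding surface_meromorphic_def
      by (auto intro: meromorphic_on_subset)
    then have "isolated_singularity_at (f \<circ> inv_into U \<phi>) (\<phi> x)"
      "not_essential (f \<circ> inv_into U \<phi>) (\<phi> x)" by (auto simp: meromorphic_at_iff)
    from non_zero_neighbour[OF this] \<open>x \<notin> N\<close> show "x \<in> Z"
      unfolding N_def Z_def
      by (auto simp: eventually_at_chart[OF c] frequently_def)
  qed auto
  moreover have "Z \<inter> N = {}"
  proof safe
    fix x assume "x \<in> Z" "x \<in> N"
    then have "\<forall>\<^sub>F y in at x. f y = 0 \<and> f y \<noteq> 0"
      unfolding Z_def N_def mem_Collect_eq by (rule eventually_conj)
    then show "x \<in> {}" by simp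
  qed
  moreover have "open Z" "open N" unfolding Z_def N_def by (rule opn)+
  ultimately have "Z = {} \<or> N = {}"
    using connectedD[OF connected_surface, of Z N] by auto
  then have "Z = UNIV \<or> N = UNIV" using \<open>Z \<union> N = UNIV\<close> by auto
  then show ?thesis unfolding Z_def N_def by auto
qed

lemma surface_meromorphic_arith:
  assumes "surface_meromorphic f"
  shows "surface_meromorphic (\<lambda>x. - f x)" "surface_meromorphic (\<lambda>x. inverse (f x))"
  using assms by (auto simp: surface_meromorphic_def o_def intro!: meromorphic_intros)

lemma surface_meromorphic_arith2:
  assumes "surface_meromorphic f" "surface_meromorphic g"
  shows "surface_meromorphic (\<lambda>x. f x + g x)" "surface_meromorphic (\<lambda>x. f x - g x)"
    "surface_meromorphic (\<lambda>x. f x * g x)" "surface_meromorphic (\<lambda>x. f x / g x)"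
  using assms by (auto simp: surface_meromorphic_def o_def intro!: meromorphic_intros)

lemmas surface_meromorphic_intros =
  surface_meromorphic_const surface_meromorphic_arith surface_meromorphic_arith2

lemma mero_eq_cong:
  assumes "mero_eq f f'" "surface_meromorphic (\<lambda>x. h (f x))" "surface_meromorphic (\<lambda>x. h (f' x))"
  shows "mero_eq (\<lambda>x. h (f x)) (\<lambda>x. h (f' x))"
proof -
  have "eventually (\<lambda>x. f x = f' x) (cosparse UNIV)"
    using assms(1) by (simp add: mero_eq_def)
  then have "eventually (\<lambda>x. h (f x) = h (f' x)) (cosparse UNIV)"
    by (rule eventually_mono) simp
  then show ?thesis using assms(2,3) by (simp add: mero_eq_def)
qed

lemma mero_eq_cong2:
  assumes "mero_eq f f'" "mero_eq g g'"
    and "surface_meromorphic (\<lambda>x. h (f x) (g x))" "surface_meromorphic (\<lambda>x. h (f' x) (g' x))"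
  shows "mero_eq (\<lambda>x. h (f x) (g x)) (\<lambda>x. h (f' x) (g' x))"
proof -
  have "eventually (\<lambda>x. f x = f' x) (cosparse UNIV)" "eventually (\<lambda>x. g x = g' x) (cosparse UNIV)"
    using assms(1,2) by (simp_all add: mero_eq_def)
  then have "eventually (\<lambda>x. h (f x) (g x) = h (f' x) (g' x)) (cosparse UNIV)"
    by (rule eventually_elim2) simp
  then show ?thesis using assms(3,4) by (simp add: mero_eq_def)
qed

lemma mero_eqI:
  assumes "surface_meromorphic f" "\<And>x. f x = g x"
  shows "mero_eq f g"
proof -
  have "f = g" using assms(2) by (rule ext)
  then show ?thesis using assms(1) by (simp add: mero_eq_def)
qed

lemma mero_eqD: "mero_eq f g \<Longrightarrow> surface_meromorphic f" "mero_eq f g \<Longrightarrow> surface_meromorphic g"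
  by (simp_all add: mero_eq_def)

instantiation mero :: (riemann_surface) field
begin

lift_definition zero_mero :: "'a mero" is "\<lambda>_. 0"
  by (intro mero_eqI surface_meromorphic_intros refl)

lift_definition one_mero :: "'a mero" is "\<lambda>_. 1"
  by (intro mero_eqI surface_meromorphic_intros refl)

lift_definition plus_mero :: "'a mero \<Rightarrow> 'a mero \<Rightarrow> 'a mero" is "\<lambda>f g x. f x + g x"
  by (rule mero_eq_cong2, assumption, assumption;
      intro surface_meromorphic_intros; erule mero_eqD)

lift_definition minus_mero :: "'a mero \<Rightarrow> 'a mero \<Rightarrow> 'a mero" is "\<lambda>f g x. f x - g x"
  by (rule mero_eq_cong2, assumption, assumption;
      intro surface_meromorphic_intros; erule mero_eqD)

lift_definition uminus_mero :: "'a mero \<Rightarrow> 'a mero" is "\<lambda>f x. - f x"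
  by (rule mero_eq_cong, assumption; intro surface_meromorphic_intros; erule mero_eqD)

lift_definition times_mero :: "'a mero \<Rightarrow> 'a mero \<Rightarrow> 'a mero" is "\<lambda>f g x. f x * g x"
  by (rule mero_eq_cong2, assumption, assumption;
      intro surface_meromorphic_intros; erule mero_eqD)

lift_definition inverse_mero :: "'a mero \<Rightarrow> 'a mero" is "\<lambda>f x. inverse (f x)"
  by (rule mero_eq_cong, assumption; intro surface_meromorphic_intros; erule mero_eqD)

lift_definition divide_mero :: "'a mero \<Rightarrow> 'a mero \<Rightarrow> 'a mero" is "\<lambda>f g x. f x / g x"
  by (rule mero_eq_cong2, assumption, assumption;
      intro surface_meromorphic_intros; erule mero_eqD)

instance
proof
  fix f g h :: "'a mero"
  show "f * g * h = f * (g * h)"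
    by (transfer, rule mero_eqI, (intro surface_meromorphic_intros; erule mero_eqD),
        simp add: field_simps)
  show "f * g = g * f"
    by (transfer, rule mero_eqI, (intro surface_meromorphic_intros; erule mero_eqD),
        simp add: field_simps)
  show "1 * f = f"
    by (transfer, rule mero_eqI, (intro surface_meromorphic_intros; erule mero_eqD),
        simp add: field_simps)
  show "f + g + h = f + (g + h)"
    by (transfer, rule mero_eqI, (intro surface_meromorphic_intros; erule mero_eqD),
        simp add: field_simps)
  show "f + g = g + f"
    by (transfer, rule mero_eqI, (intro surface_meromorphic_intros; erule mero_eqD),
        simp add: field_simps)
  show "0 + f = f"
    by (transfer, rule mero_eqI, (intro surface_meromorphic_intros; erule mero_eqD),
        simp add: field_simps)
  show "- f + f = 0"
    by (transfer, rule mero_eqI, (intro surface_meromorphic_intros; erule mero_eqD),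
        simp add: field_simps)
  show "f - g = f + - g"
    by (transfer, rule mero_eqI, (intro surface_meromorphic_intros; erule mero_eqD),
        simp add: field_simps)
  show "(f + g) * h = f * h + g * h"
    by (transfer, rule mero_eqI, (intro surface_meromorphic_intros; erule mero_eqD),
        simp add: field_simps)
  show "f div g = f * inverse g"
    by (transfer, rule mero_eqI, (intro surface_meromorphic_intros; erule mero_eqD),
        simp add: field_simps)
  show "inverse 0 = (0 :: 'a mero)"
    by (transfer, rule mero_eqI, (intro surface_meromorphic_intros; erule mero_eqD),
        simp add: field_simps)
  show "(0 :: 'a mero) \<noteq> 1"
    by transfer (simp add: mero_eq_def)
  show "inverse f * f = 1" if "f \<noteq> 0"
    using that
  proof transfer
    fix f :: "'a \<Rightarrow> complex"
    assume f: "mero_eq f f" "\<not> mero_eq f (\<lambda>_. 0)"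
    note mer = mero_eqD(1)[OF f(1)]
    have ev: "\<forall>\<^sub>F y in at x. f y \<noteq> 0" for x
      using surface_meromorphic_zero_or_nonzero[OF mer] f(2) mer
      by (auto simp: mero_eq_iff surface_meromorphic_const)
    have "\<forall>\<^sub>F y in at x. inverse (f y) * f y = 1" for x
      by (rule eventually_mono[OF ev]) simp
    then show "mero_eq (\<lambda>x. inverse (f x) * f x) (\<lambda>_. 1)"
      using mer by (simp add: mero_eq_iff surface_meromorphic_intros)
  qed
qed

end

lift_definition mero_const :: "complex \<Rightarrow> 'a::riemann_surface mero" is "\<lambda>c _. c"
  by (intro mero_eqI surface_meromorphic_intros refl)
section \<open>Rational differential operators over a differential field\<close>

text \<open>\<open>rdo_X k\<close> is the indeterminate standing for the \<open>k\<close>-th iterate of the derivation \<open>\<delta>\<close> of the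
  coefficient field; \<open>\<delta>\<close> enters only through \<open>rdo_deriv\<close> and hence the composition.  The monomial \<open>X\<^sub>0 ^ m 0 * X\<^sub>1 ^ m 1 * \<dots>\<close> is encoded by its exponent function \<open>m\<close>.\<close>

type_synonym 'k diff_poly = "(nat \<Rightarrow>\<^sub>0 nat) \<Rightarrow>\<^sub>0 'k"

type_synonym 'k rdo = "'k diff_poly fract"

definition rdo_const :: "'k::field \<Rightarrow> 'k rdo" where
  "rdo_const a = Fract (Poly_Mapping.single 0 a) 1"

definition rdo_X :: "nat \<Rightarrow> 'k::field rdo" where
  "rdo_X k = Fract (Poly_Mapping.single (Poly_Mapping.single k 1) 1) 1"

definition derivation :: "('r::comm_ring_1 \<Rightarrow> 'r) \<Rightarrow> bool" where
  "derivation D \<longleftrightarrow> (\<forall>x y. D (x + y) = D x + D y) \<and> (\<forall>x y. D (x * y) = D x * y + x * D y)"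

definition rdo_deriv :: "('k::field \<Rightarrow> 'k) \<Rightarrow> 'k rdo \<Rightarrow> 'k rdo" where
  "rdo_deriv \<delta> = (THE D. derivation D \<and> (\<forall>a. D (rdo_const a) = rdo_const (\<delta> a)) \<and>
     (\<forall>k. D (rdo_X k) = rdo_X (Suc k)))"

definition diff_poly_subst :: "('k::field \<Rightarrow> 'k) \<Rightarrow> 'k rdo \<Rightarrow> 'k diff_poly \<Rightarrow> 'k rdo" where
  "diff_poly_subst \<delta> Q p =
     (\<Sum>m\<in>Poly_Mapping.keys p. rdo_const (Poly_Mapping.lookup p m) *
        (\<Prod>k\<in>Poly_Mapping.keys m. (rdo_deriv \<delta> ^^ k) Q ^ Poly_Mapping.lookup m k))"

text \<open>\<open>R \<circ> Q\<close> is defined iff \<open>R\<close> has a representation as a fraction whose denominator does not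
  vanish after the substitution.\<close>

definition rdo_composable :: "('k::field \<Rightarrow> 'k) \<Rightarrow> 'k rdo \<Rightarrow> 'k rdo \<Rightarrow> bool" where
  "rdo_composable \<delta> R Q \<longleftrightarrow> (\<exists>p q. R = Fract p q \<and> diff_poly_subst \<delta> Q q \<noteq> 0)"

definition rdo_comp :: "('k::field \<Rightarrow> 'k) \<Rightarrow> 'k rdo \<Rightarrow> 'k rdo \<Rightarrow> 'k rdo" where
  "rdo_comp \<delta> R Q = (THE S. \<exists>p q. R = Fract p q \<and> diff_poly_subst \<delta> Q q \<noteq> 0 \<and>
     S = diff_poly_subst \<delta> Q p / diff_poly_subst \<delta> Q q)"

subsection \<open>The derivation and the composition are well defined\<close>

lemma derivation_add: "derivation D \<Longrightarrow> D (x + y) = D x + D y"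
  and derivation_mult: "derivation D \<Longrightarrow> D (x * y) = D x * y + x * D y"
  by (simp_all add: derivation_def)

lemma derivation_0: assumes "derivation D" shows "D 0 = 0"
  using derivation_add[OF assms, of 0 0] by simp

lemma derivation_1: assumes "derivation D" shows "D 1 = 0"
  using derivation_mult[OF assms, of 1 1] by simp

lemma derivation_sum: "derivation D \<Longrightarrow> D (sum f A) = (\<Sum>x\<in>A. D (f x))"
  by (induction A rule: infinite_finite_induct) (simp_all add: derivation_0 derivation_add)

lemma diff_poly_sum_monomials:
  "(\<Sum>m\<in>Poly_Mapping.keys p. Poly_Mapping.single m (Poly_Mapping.lookup p m)) = p"
proof (rule poly_mapping_eqI)
  fix n
  have "Poly_Mapping.lookup (\<Sum>m\<in>Poly_Mapping.keys p. Poly_Mapping.single m (Poly_Mapping.lookup p m)) n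
    = (\<Sum>m\<in>Poly_Mapping.keys p. if m = n then Poly_Mapping.lookup p n else 0)"
    unfolding lookup_sum by (rule sum.cong) (auto simp: lookup_single when_def)
  then show "Poly_Mapping.lookup (\<Sum>m\<in>Poly_Mapping.keys p. Poly_Mapping.single m (Poly_Mapping.lookup p m)) n
    = Poly_Mapping.lookup p n"
    by (simp add: in_keys_iff)
qed

definition monom_deriv :: "(nat \<Rightarrow>\<^sub>0 nat) \<Rightarrow> 'k::field diff_poly" where
  "monom_deriv m = (\<Sum>k\<in>Poly_Mapping.keys m. of_nat (Poly_Mapping.lookup m k) *
     Poly_Mapping.single (m - Poly_Mapping.single k 1 + Poly_Mapping.single (Suc k) 1) 1)"

lemma monom_deriv_superset:
  assumes "finite A" "Poly_Mapping.keys m \<subseteq> A"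
  shows "monom_deriv m = (\<Sum>k\<in>A. of_nat (Poly_Mapping.lookup m k) *
     Poly_Mapping.single (m - Poly_Mapping.single k 1 + Poly_Mapping.single (Suc k) 1) 1)"
  unfolding monom_deriv_def
  by (rule sum.mono_neutral_left) (use assms in \<open>auto simp: in_keys_iff\<close>)

lemma monom_deriv_0: "monom_deriv 0 = 0"
  by (simp add: monom_deriv_def)

lemma monom_deriv_add:
  "monom_deriv (m + n) =
     monom_deriv m * Poly_Mapping.single n 1 + Poly_Mapping.single m 1 * monom_deriv n"
proof -
  let ?A = "Poly_Mapping.keys m \<union> Poly_Mapping.keys n"
  let ?e = "\<lambda>k m. m - Poly_Mapping.single k 1 + Poly_Mapping.single (Suc k) 1 :: nat \<Rightarrow>\<^sub>0 nat"
  let ?t = "\<lambda>k m. of_nat (Poly_Mapping.lookup m k) * Poly_Mapping.single (?e k m) 1 :: 'a diff_poly"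
  have shift: "of_nat (Poly_Mapping.lookup m k) * Poly_Mapping.single (?e k (m + n)) (1::'a) =
      ?t k m * Poly_Mapping.single n 1" for m n k
  proof (cases "Poly_Mapping.lookup m k = 0")
    case False
    have "?e k (m + n) = ?e k m + n"
      using False by (intro poly_mapping_eqI) (auto simp: lookup_add lookup_minus lookup_single when_def)
    then show ?thesis by (simp add: mult_single mult.assoc)
  qed simp
  have "monom_deriv (m + n) = (\<Sum>k\<in>?A. ?t k (m + n))"
    by (rule monom_deriv_superset) (use keys_add[of m n] in auto)
  also have "\<dots> = (\<Sum>k\<in>?A. ?t k m * Poly_Mapping.single n 1 + ?t k n * Poly_Mapping.single m 1)"
  proof (rule sum.cong[OF refl])
    fix k
    show "?t k (m + n) = ?t k m * Poly_Mapping.single n 1 + ?t k n * Poly_Mapping.single m 1"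
      unfolding shift[of m k n, symmetric] shift[of n k m, symmetric] add.commute[of n m]
      unfolding lookup_add of_nat_add distrib_right ..
  qed
  also have "\<dots> = (\<Sum>k\<in>?A. ?t k m) * Poly_Mapping.single n 1 + (\<Sum>k\<in>?A. ?t k n) * Poly_Mapping.single m 1"
    by (simp add: sum.distrib sum_distrib_right)
  also have "(\<Sum>k\<in>?A. ?t k m) = monom_deriv m"
    by (rule monom_deriv_superset[symmetric]) auto
  also have "(\<Sum>k\<in>?A. ?t k n) = monom_deriv n"
    by (rule monom_deriv_superset[symmetric]) auto
  finally show ?thesis by (simp add: mult.commute)
qed

lemma monom_deriv_X:
  "monom_deriv (Poly_Mapping.single k 1) = Poly_Mapping.single (Poly_Mapping.single (Suc k) 1) 1"
  by (simp add: monom_deriv_def)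

definition diff_poly_deriv :: "('k::field \<Rightarrow> 'k) \<Rightarrow> 'k diff_poly \<Rightarrow> 'k diff_poly" where
  "diff_poly_deriv \<delta> p = (\<Sum>m\<in>Poly_Mapping.keys p.
     Poly_Mapping.single m (\<delta> (Poly_Mapping.lookup p m)) +
     Poly_Mapping.single 0 (Poly_Mapping.lookup p m) * monom_deriv m)"

lemma diff_poly_deriv_superset:
  assumes "derivation \<delta>" "finite A" "Poly_Mapping.keys p \<subseteq> A"
  shows "diff_poly_deriv \<delta> p = (\<Sum>m\<in>A.
     Poly_Mapping.single m (\<delta> (Poly_Mapping.lookup p m)) +
     Poly_Mapping.single 0 (Poly_Mapping.lookup p m) * monom_deriv m)"
  unfolding diff_poly_deriv_def
  by (rule sum.mono_neutral_left) (use assms in \<open>auto simp: in_keys_iff derivation_0\<close>)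

lemma diff_poly_deriv_add:
  assumes "derivation \<delta>"
  shows "diff_poly_deriv \<delta> (p + q) = diff_poly_deriv \<delta> p + diff_poly_deriv \<delta> q"
proof -
  let ?A = "Poly_Mapping.keys p \<union> Poly_Mapping.keys q"
  have s: "diff_poly_deriv \<delta> r = (\<Sum>m\<in>?A.
     Poly_Mapping.single m (\<delta> (Poly_Mapping.lookup r m)) +
     Poly_Mapping.single 0 (Poly_Mapping.lookup r m) * monom_deriv m)"
    if "Poly_Mapping.keys r \<subseteq> ?A" for r
    by (rule diff_poly_deriv_superset[OF assms _ that]) simp
  show ?thesis
    using keys_add[of p q]
    by (simp add: s lookup_add derivation_add[OF assms] single_add ring_distribs sum.distrib)
qed

lemma diff_poly_deriv_single:
  assumes "derivation \<delta>"
  shows "diff_poly_deriv \<delta> (Poly_Mapping.single m a) =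
    Poly_Mapping.single m (\<delta> a) + Poly_Mapping.single 0 a * monom_deriv m"
  by (subst diff_poly_deriv_superset[OF assms, of "{m}"]) auto

lemma derivation_diff_poly_deriv:
  assumes "derivation \<delta>"
  shows "derivation (diff_poly_deriv \<delta>)"
  unfolding derivation_def
proof (intro conjI allI)
  let ?D = "diff_poly_deriv \<delta>"
  show add: "?D (p + q) = ?D p + ?D q" for p q by (rule diff_poly_deriv_add[OF assms])
  have D0: "?D 0 = 0" by (simp add: diff_poly_deriv_def)
  have sum: "?D (sum f A) = (\<Sum>x\<in>A. ?D (f x))" for f and A :: "(nat \<Rightarrow>\<^sub>0 nat) set"
    by (induction A rule: infinite_finite_induct) (simp_all add: D0 add)
  have single: "?D (Poly_Mapping.single m a * Poly_Mapping.single n b) =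
      ?D (Poly_Mapping.single m a) * Poly_Mapping.single n b +
      Poly_Mapping.single m a * ?D (Poly_Mapping.single n b)" for m n a b
  proof -
    let ?M = "Poly_Mapping.single m 1 :: 'a diff_poly" and ?N = "Poly_Mapping.single n 1 :: 'a diff_poly"
    let ?c = "\<lambda>x. Poly_Mapping.single 0 x :: 'a diff_poly"
    have m: "Poly_Mapping.single m x = ?M * ?c x" and n: "Poly_Mapping.single n x = ?N * ?c x" for x
      by (simp_all add: mult_single)
    have mn: "Poly_Mapping.single (m + n) (x * y) = ?M * ?N * (?c x * ?c y)"
      and c: "?c (x * y) = ?c x * ?c y" for x y
      by (simp_all add: mult_single)
    have "?D (Poly_Mapping.single m a * Poly_Mapping.single n b) =
        ?M * ?N * (?c (\<delta> a) * ?c b) + ?M * ?N * (?c a * ?c (\<delta> b)) +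
        ?c a * ?c b * (monom_deriv m * ?N + ?M * monom_deriv n)"
      unfolding mult_single[of m a n b] diff_poly_deriv_single[OF assms] monom_deriv_add
        derivation_mult[OF assms] single_add
      unfolding mn c ..
    also have "\<dots> = (?M * ?c (\<delta> a) + ?c a * monom_deriv m) * (?N * ?c b) +
        (?M * ?c a) * (?N * ?c (\<delta> b) + ?c b * monom_deriv n)"
      by (simp only: ring_distribs ac_simps)
    also have "\<dots> = ?D (Poly_Mapping.single m a) * Poly_Mapping.single n b +
        Poly_Mapping.single m a * ?D (Poly_Mapping.single n b)"
      unfolding diff_poly_deriv_single[OF assms]
      unfolding m[of a] m[of "\<delta> a"] n[of b] n[of "\<delta> b"] ..
    finally show ?thesis .
  qed
  show "?D (p * q) = ?D p * q + p * ?D q" for p q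
  proof -
    let ?s = "\<lambda>p m. Poly_Mapping.single m (Poly_Mapping.lookup p m)"
    let ?P = "Poly_Mapping.keys p" and ?Q = "Poly_Mapping.keys q"
    have "?D (sum (?s p) ?P * sum (?s q) ?Q) = (\<Sum>m\<in>?P. \<Sum>n\<in>?Q. ?D (?s p m * ?s q n))"
      by (simp only: sum_product sum)
    also have "\<dots> = (\<Sum>m\<in>?P. ?D (?s p m)) * sum (?s q) ?Q + sum (?s p) ?P * (\<Sum>n\<in>?Q. ?D (?s q n))"
      by (simp only: single sum_product sum.distrib)
    also have "\<dots> = ?D (sum (?s p) ?P) * sum (?s q) ?Q + sum (?s p) ?P * ?D (sum (?s q) ?Q)"
      by (simp only: sum)
    finally show ?thesis by (simp only: diff_poly_sum_monomials)
  qed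
qed

lemma fract_of_derivation:
  fixes d :: "'a::idom \<Rightarrow> 'a"
  assumes d: "derivation d"
  shows "\<exists>D. derivation D \<and> (\<forall>p. D (Fract p 1) = Fract (d p) 1)"
proof -
  define N where "N = (\<lambda>(p, q). Fract (d p * q - p * d q) (q * q))"
  define D where "D R = N (SOME pq. R = Fract (fst pq) (snd pq) \<and> snd pq \<noteq> 0)" for R
  have D: "D (Fract p q) = Fract (d p * q - p * d q) (q * q)" if "q \<noteq> 0" for p q
  proof -
    let ?r = "SOME pq. Fract p q = Fract (fst pq) (snd pq) \<and> snd pq \<noteq> 0"
    obtain p' q' where r: "?r = (p', q')" by fastforce
    have "Fract p q = Fract (fst ?r) (snd ?r) \<and> snd ?r \<noteq> 0"
      by (rule someI[of _ "(p, q)"]) (use that in simp)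
    then have q': "q' \<noteq> 0" and "Fract p q = Fract p' q'" by (simp_all add: r)
    then have e: "p * q' = p' * q" using that by (simp add: eq_fract)
    have "d p * q' + p * d q' = d p' * q + p' * d q"
      using arg_cong[OF e, of d] by (simp add: derivation_mult[OF d])
    then have e': "d p' * q - p * d q' = d p * q' - p' * d q" by (simp add: algebra_simps)
    have "(d p' * q' - p' * d q') * (q * q) = q * q' * (d p' * q) - (p' * q) * q * d q'"
      by (simp add: algebra_simps)
    also have "\<dots> = q * q' * (d p' * q - p * d q')"
      unfolding e[symmetric] by (simp add: algebra_simps)
    also have "\<dots> = q * q' * (d p * q') - (p' * q) * q' * d q"
      unfolding e' by (simp add: algebra_simps)
    also have "\<dots> = (d p * q - p * d q) * (q' * q')"
      unfolding e[symmetric] by (simp add: algebra_simps)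
    finally show ?thesis
      using that q' unfolding D_def r N_def by (simp add: eq_fract)
  qed
  have "derivation D"
    unfolding derivation_def
  proof (intro conjI allI)
    fix x y :: "'a fract"
    obtain p q where x: "x = Fract p q" "q \<noteq> 0" by (cases x)
    obtain r s where y: "y = Fract r s" "s \<noteq> 0" by (cases y)
    show "D (x + y) = D x + D y"
      using x(2) y(2) unfolding x(1) y(1)
      by (simp add: D eq_fract derivation_add[OF d] derivation_mult[OF d]) (simp add: algebra_simps)
    show "D (x * y) = D x * y + x * D y"
      using x(2) y(2) unfolding x(1) y(1)
      by (simp add: D eq_fract derivation_add[OF d] derivation_mult[OF d]) (simp add: algebra_simps)
  qed
  moreover have "D (Fract p 1) = Fract (d p) 1" for p
    by (simp add: D derivation_1[OF d])
  ultimately show ?thesis by blast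
qed

lemma monomial_prod:
  fixes m :: "nat \<Rightarrow>\<^sub>0 nat"
  shows "Poly_Mapping.single m (1 :: 'k::comm_semiring_1) =
     (\<Prod>k\<in>Poly_Mapping.keys m. Poly_Mapping.single (Poly_Mapping.single k 1) 1 ^ Poly_Mapping.lookup m k)"
proof -
  have pow: "Poly_Mapping.single (Poly_Mapping.single k j) (1 :: 'k) =
      Poly_Mapping.single (Poly_Mapping.single k 1) 1 ^ j" for j k :: nat
  proof (induction j)
    case (Suc j)
    have "Poly_Mapping.single k (Suc j) = Poly_Mapping.single k 1 + Poly_Mapping.single k j"
      by (simp flip: single_add)
    then show ?case by (simp only: mult_single mult_1_left power_Suc flip: Suc.IH)
  qed simp
  have "Poly_Mapping.single (sum f A) (1 :: 'k) = (\<Prod>k\<in>A. Poly_Mapping.single (f k) 1)"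
    for f :: "nat \<Rightarrow> nat \<Rightarrow>\<^sub>0 nat" and A
    by (induction A rule: infinite_finite_induct)
      (simp_all, metis mult_single mult_1_left)
  note this[of "\<lambda>k. Poly_Mapping.single k (Poly_Mapping.lookup m k)" "Poly_Mapping.keys m"]
  then have "Poly_Mapping.single m (1 :: 'k) =
      (\<Prod>k\<in>Poly_Mapping.keys m. Poly_Mapping.single (Poly_Mapping.single k (Poly_Mapping.lookup m k)) 1)"
    by (simp only: diff_poly_sum_monomials)
  also have "\<dots> = (\<Prod>k\<in>Poly_Mapping.keys m.
      Poly_Mapping.single (Poly_Mapping.single k 1) 1 ^ Poly_Mapping.lookup m k)"
    by (rule prod.cong[OF refl], rule pow)
  finally show ?thesis .
qed

lemma Fract_poly_hom:
  "Fract (p + q) 1 = Fract p 1 + Fract q 1" "Fract (p * q) 1 = Fract p 1 * Fract q 1"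
  by simp_all

lemma Fract_sum: "Fract (sum f A) 1 = (\<Sum>x\<in>A. Fract (f x) 1)"
  by (induction A rule: infinite_finite_induct) (simp_all add: fract_collapse Fract_poly_hom del: add_fract mult_fract)

lemma Fract_prod: "Fract (prod f A) 1 = (\<Prod>x\<in>A. Fract (f x) 1)"
  by (induction A rule: infinite_finite_induct) (simp_all add: fract_collapse Fract_poly_hom del: add_fract mult_fract)

lemma Fract_power: "Fract (p ^ n) 1 = Fract p 1 ^ n"
  by (induction n) (simp_all add: fract_collapse Fract_poly_hom del: add_fract mult_fract)

lemma Fract_diff_poly:
  "Fract p 1 = (\<Sum>m\<in>Poly_Mapping.keys p. rdo_const (Poly_Mapping.lookup p m) *
     (\<Prod>k\<in>Poly_Mapping.keys m. rdo_X k ^ Poly_Mapping.lookup m k))"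
proof -
  have "Fract (Poly_Mapping.single m a) 1 =
      rdo_const a * (\<Prod>k\<in>Poly_Mapping.keys m. rdo_X k ^ Poly_Mapping.lookup m k)" for m and a :: 'a
  proof -
    have "Fract (Poly_Mapping.single m a) 1 = rdo_const a * Fract (Poly_Mapping.single m 1) 1"
      by (simp add: rdo_const_def mult_single)
    then show ?thesis
      by (simp only: monomial_prod[of m] Fract_prod Fract_power rdo_X_def)
  qed
  then have "Fract (\<Sum>m\<in>Poly_Mapping.keys p. Poly_Mapping.single m (Poly_Mapping.lookup p m)) 1 =
    (\<Sum>m\<in>Poly_Mapping.keys p. rdo_const (Poly_Mapping.lookup p m) *
     (\<Prod>k\<in>Poly_Mapping.keys m. rdo_X k ^ Poly_Mapping.lookup m k))"
    by (simp only: Fract_sum)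
  then show ?thesis by (simp only: diff_poly_sum_monomials)
qed

lemma derivation_eqI:
  fixes D E :: "'k::field rdo \<Rightarrow> 'k rdo"
  assumes D: "derivation D" and E: "derivation E"
    and const: "\<And>a. D (rdo_const a) = E (rdo_const a)" and X: "\<And>k. D (rdo_X k) = E (rdo_X k)"
  shows "D = E"
proof
  have add: "D (x + y) = E (x + y)" if "D x = E x" "D y = E y" for x y
    using that by (simp add: derivation_add[OF D] derivation_add[OF E])
  have mult: "D (x * y) = E (x * y)" if "D x = E x" "D y = E y" for x y
    using that by (simp add: derivation_mult[OF D] derivation_mult[OF E])
  note zo = derivation_0[OF D] derivation_0[OF E] derivation_1[OF D] derivation_1[OF E]
  have sum: "D (sum f A) = E (sum f A)" if "\<And>x. D (f x) = E (f x)"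
    for f and A :: "(nat \<Rightarrow>\<^sub>0 nat) set"
    by (induction A rule: infinite_finite_induct) (simp_all add: zo add that)
  have prod: "D (prod f A) = E (prod f A)" if "\<And>x. D (f x) = E (f x)" for f and A :: "nat set"
    by (induction A rule: infinite_finite_induct) (simp_all add: zo mult that)
  have power: "D (x ^ n) = E (x ^ n)" if "D x = E x" for x n
    by (induction n) (simp_all add: zo mult that)
  have poly: "D (Fract p 1) = E (Fract p 1)" for p
    unfolding Fract_diff_poly by (intro sum mult const prod power X)
  fix R :: "'k rdo"
  obtain p q where R: "R = Fract p q" "q \<noteq> 0" by (cases R)
  have e: "R * Fract q 1 = Fract p 1" using R by (simp add: eq_fract)
  have nz: "Fract q 1 \<noteq> 0" using R(2) by (simp add: fract_expand eq_fract)
  have "D R * Fract q 1 = D (Fract p 1) - R * D (Fract q 1)"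
    by (simp only: e[symmetric] derivation_mult[OF D]) simp
  also have "\<dots> = E (Fract p 1) - R * E (Fract q 1)"
    by (simp only: poly)
  also have "\<dots> = E R * Fract q 1"
    by (simp only: e[symmetric] derivation_mult[OF E]) simp
  finally show "D R = E R" using nz by simp
qed

lemma rdo_deriv_ex1:
  assumes "derivation \<delta>"
  shows "\<exists>!D. derivation D \<and> (\<forall>a. D (rdo_const a) = rdo_const (\<delta> a)) \<and>
     (\<forall>k. D (rdo_X k) = rdo_X (Suc k))"
proof (rule ex_ex1I)
  obtain D where D: "derivation D" "\<And>p. D (Fract p 1) = Fract (diff_poly_deriv \<delta> p) 1"
    using fract_of_derivation[OF derivation_diff_poly_deriv[OF assms]] by blast
  have "D (rdo_const a) = rdo_const (\<delta> a)" for a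
    by (simp add: rdo_const_def D diff_poly_deriv_single[OF assms] monom_deriv_0)
  moreover have "D (rdo_X k) = rdo_X (Suc k)" for k
    unfolding rdo_X_def D diff_poly_deriv_single[OF assms] monom_deriv_X
    by (simp add: derivation_1[OF assms])
  ultimately show "\<exists>D. derivation D \<and> (\<forall>a. D (rdo_const a) = rdo_const (\<delta> a)) \<and>
     (\<forall>k. D (rdo_X k) = rdo_X (Suc k))" using D(1) by blast
qed (auto intro!: derivation_eqI)

lemma rdo_deriv:
  assumes "derivation \<delta>"
  shows "derivation (rdo_deriv \<delta>)" "rdo_deriv \<delta> (rdo_const a) = rdo_const (\<delta> a)"
    "rdo_deriv \<delta> (rdo_X k) = rdo_X (Suc k)"
  using theI'[OF rdo_deriv_ex1[OF assms]] unfolding rdo_deriv_def[symmetric] by auto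

lemma rdo_const_hom:
  "rdo_const 0 = 0" "rdo_const 1 = 1" "rdo_const (a + b) = rdo_const a + rdo_const b"
  "rdo_const (a * b) = rdo_const a * rdo_const b"
  by (simp_all add: rdo_const_def fract_collapse single_add mult_single)

lemma diff_poly_subst_superset:
  assumes "finite A" "Poly_Mapping.keys p \<subseteq> A"
  shows "diff_poly_subst \<delta> Q p = (\<Sum>m\<in>A. rdo_const (Poly_Mapping.lookup p m) *
        (\<Prod>k\<in>Poly_Mapping.keys m. (rdo_deriv \<delta> ^^ k) Q ^ Poly_Mapping.lookup m k))"
  unfolding diff_poly_subst_def
  by (rule sum.mono_neutral_left) (use assms in \<open>auto simp: in_keys_iff rdo_const_hom\<close>)

lemma diff_poly_subst_add:
  "diff_poly_subst \<delta> Q (p + q) = diff_poly_subst \<delta> Q p + diff_poly_subst \<delta> Q q"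
proof -
  let ?A = "Poly_Mapping.keys p \<union> Poly_Mapping.keys q"
  have s: "diff_poly_subst \<delta> Q r = (\<Sum>m\<in>?A. rdo_const (Poly_Mapping.lookup r m) *
        (\<Prod>k\<in>Poly_Mapping.keys m. (rdo_deriv \<delta> ^^ k) Q ^ Poly_Mapping.lookup m k))"
    if "Poly_Mapping.keys r \<subseteq> ?A" for r
    by (rule diff_poly_subst_superset[OF _ that]) simp
  show ?thesis
    using keys_add[of p q] by (simp add: s lookup_add rdo_const_hom ring_distribs sum.distrib)
qed

lemma diff_poly_subst_single:
  "diff_poly_subst \<delta> Q (Poly_Mapping.single m a) =
     rdo_const a * (\<Prod>k\<in>Poly_Mapping.keys m. (rdo_deriv \<delta> ^^ k) Q ^ Poly_Mapping.lookup m k)"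
  by (subst diff_poly_subst_superset[of "{m}"]) auto

lemma diff_poly_subst_mult:
  "diff_poly_subst \<delta> Q (p * q) = diff_poly_subst \<delta> Q p * diff_poly_subst \<delta> Q q"
proof -
  let ?S = "diff_poly_subst \<delta> Q"
  let ?s = "\<lambda>p m. Poly_Mapping.single m (Poly_Mapping.lookup p m)"
  let ?P = "Poly_Mapping.keys p" and ?Q = "Poly_Mapping.keys q"
  let ?x = "\<lambda>k. (rdo_deriv \<delta> ^^ k) Q"
  have S0: "?S 0 = 0" by (simp add: diff_poly_subst_def)
  have sum: "?S (sum f A) = (\<Sum>x\<in>A. ?S (f x))" for f and A :: "(nat \<Rightarrow>\<^sub>0 nat) set"
    by (induction A rule: infinite_finite_induct) (simp_all add: S0 diff_poly_subst_add)
  have prod: "(\<Prod>k\<in>Poly_Mapping.keys m. ?x k ^ Poly_Mapping.lookup m k) =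
      (\<Prod>k\<in>A. ?x k ^ Poly_Mapping.lookup m k)" if "finite A" "Poly_Mapping.keys m \<subseteq> A" for m A
    by (rule prod.mono_neutral_left) (use that in \<open>auto simp: in_keys_iff\<close>)
  have single: "?S (Poly_Mapping.single m a * Poly_Mapping.single n b) =
      ?S (Poly_Mapping.single m a) * ?S (Poly_Mapping.single n b)" for m n a b
  proof -
    let ?A = "Poly_Mapping.keys m \<union> Poly_Mapping.keys n"
    have mn: "(\<Prod>k\<in>Poly_Mapping.keys (m + n). ?x k ^ Poly_Mapping.lookup (m + n) k) =
        (\<Prod>k\<in>Poly_Mapping.keys m. ?x k ^ Poly_Mapping.lookup m k) *
        (\<Prod>k\<in>Poly_Mapping.keys n. ?x k ^ Poly_Mapping.lookup n k)"
      using prod[of ?A "m + n"] prod[of ?A m] prod[of ?A n] keys_add[of m n]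
      by (simp add: lookup_add power_add prod.distrib)
    show ?thesis
      unfolding mult_single diff_poly_subst_single rdo_const_hom mn by (simp only: ac_simps)
  qed
  have "?S (sum (?s p) ?P * sum (?s q) ?Q) = ?S (sum (?s p) ?P) * ?S (sum (?s q) ?Q)"
    by (simp only: sum_product sum single)
  then show ?thesis by (simp only: diff_poly_sum_monomials)
qed

lemma rdo_comp_Fract:
  assumes "diff_poly_subst \<delta> Q q \<noteq> 0"
  shows "rdo_comp \<delta> (Fract p q) Q = diff_poly_subst \<delta> Q p / diff_poly_subst \<delta> Q q"
  unfolding rdo_comp_def
proof (rule the_equality)
  have nz: "q \<noteq> 0" if "diff_poly_subst \<delta> Q q \<noteq> 0" for q
    using that by (auto simp: diff_poly_subst_def)
  fix S
  assume "\<exists>p' q'. Fract p q = Fract p' q' \<and> diff_poly_subst \<delta> Q q' \<noteq> 0 \<and>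
    S = diff_poly_subst \<delta> Q p' / diff_poly_subst \<delta> Q q'"
  then obtain p' q' where pq: "Fract p q = Fract p' q'" "diff_poly_subst \<delta> Q q' \<noteq> 0"
    "S = diff_poly_subst \<delta> Q p' / diff_poly_subst \<delta> Q q'" by blast
  have "p * q' = p' * q" using pq(1) nz assms pq(2) by (simp add: eq_fract)
  then have "diff_poly_subst \<delta> Q p * diff_poly_subst \<delta> Q q' =
      diff_poly_subst \<delta> Q p' * diff_poly_subst \<delta> Q q"
    by (simp only: diff_poly_subst_mult[symmetric])
  then show "S = diff_poly_subst \<delta> Q p / diff_poly_subst \<delta> Q q"
    using assms pq(2,3) by (simp add: frac_eq_eq)
qed (use assms in blast)

section \<open>Meromorphic vector fields\<close>

text \<open>The vector field \<open>X\<close> given in the chart \<open>(U, \<phi>)\<close>, with coordinate \<open>z\<close>, by \<open>X = \<xi> z * d/dz\<close>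
  is encoded by the family \<open>X (U, \<phi>) = \<xi>\<close> of its coefficients, each again modulo sparse sets.\<close>

type_synonym 'a vector_field = "'a set \<times> ('a \<Rightarrow> complex) \<Rightarrow> complex \<Rightarrow> complex"

definition meromorphic_vector_field :: "'a::riemann_surface vector_field \<Rightarrow> bool" where
  "meromorphic_vector_field X \<longleftrightarrow>
     (\<forall>(U, \<phi>)\<in>atlas. X (U, \<phi>) meromorphic_on \<phi> ` U) \<and>
     (\<forall>(U, \<phi>)\<in>atlas. \<forall>(V, \<psi>)\<in>atlas. eventually
        (\<lambda>z. X (V, \<psi>) ((\<psi> \<circ> inv_into U \<phi>) z) = deriv (\<psi> \<circ> inv_into U \<phi>) z * X (U, \<phi>) z)
        (cosparse (\<phi> ` (U \<inter> V))))"

definition zero_vector_field :: "'a::riemann_surface vector_field \<Rightarrow> bool" where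
  "zero_vector_field X \<longleftrightarrow> (\<forall>(U, \<phi>)\<in>atlas. eventually (\<lambda>z. X (U, \<phi>) z = 0) (cosparse (\<phi> ` U)))"

text \<open>The derivation \<open>f \<mapsto> X f\<close>, in each chart \<open>\<xi> z * df/dz\<close>.\<close>

definition lie_deriv :: "'a::riemann_surface vector_field \<Rightarrow> 'a mero \<Rightarrow> 'a mero" where
  "lie_deriv X f = (THE g. \<forall>(U, \<phi>)\<in>atlas. eventually
     (\<lambda>z. (rep_mero g \<circ> inv_into U \<phi>) z = X (U, \<phi>) z * deriv (rep_mero f \<circ> inv_into U \<phi>) z)
     (cosparse (\<phi> ` U)))"

lemma eventually_cosparse_chart:
  assumes "(U, \<phi>) \<in> atlas"
  shows "eventually P (cosparse (\<phi> ` U)) \<longleftrightarrow> (\<forall>x\<in>U. eventually P (at (\<phi> x)))"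
  using eventually_cosparse_open_eq[OF chartD(2)[OF assms]] by simp

lemma mero_eq_chart:
  fixes f g :: "'a::riemann_surface \<Rightarrow> complex"
  shows "mero_eq f g \<longleftrightarrow> surface_meromorphic f \<and> surface_meromorphic g \<and>
     (\<forall>(U, \<phi>)\<in>atlas. eventually (\<lambda>z. (f \<circ> inv_into U \<phi>) z = (g \<circ> inv_into U \<phi>) z) (cosparse (\<phi> ` U)))"
proof -
  have "(\<forall>x. eventually (\<lambda>y. f y = g y) (at x)) \<longleftrightarrow>
    (\<forall>(U, \<phi>)\<in>atlas. eventually (\<lambda>z. (f \<circ> inv_into U \<phi>) z = (g \<circ> inv_into U \<phi>) z) (cosparse (\<phi> ` U)))"
  proof (intro iffI ballI allI; clarify?)
    fix U and \<phi> :: "'a \<Rightarrow> complex"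
    assume c: "(U, \<phi>) \<in> atlas" and ev: "\<forall>x. eventually (\<lambda>y. f y = g y) (at x)"
    show "eventually (\<lambda>z. (f \<circ> inv_into U \<phi>) z = (g \<circ> inv_into U \<phi>) z) (cosparse (\<phi> ` U))"
      unfolding eventually_cosparse_chart[OF c]
    proof
      fix x assume "x \<in> U"
      then show "\<forall>\<^sub>F z in at (\<phi> x). (f \<circ> inv_into U \<phi>) z = (g \<circ> inv_into U \<phi>) z"
        using spec[OF ev, of x] by (simp add: eventually_at_chart[OF c])
    qed
  next
    fix x :: 'a
    assume ev: "\<forall>(U, \<phi>)\<in>atlas. eventually
      (\<lambda>z. (f \<circ> inv_into U \<phi>) z = (g \<circ> inv_into U \<phi>) z) (cosparse (\<phi> ` U))"
    obtain U \<phi> where c: "(U, \<phi>) \<in> atlas" "x \<in> U" by (rule chart_exists)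
    have "eventually (\<lambda>z. (f \<circ> inv_into U \<phi>) z = (g \<circ> inv_into U \<phi>) z) (cosparse (\<phi> ` U))"
      using bspec[OF ev c(1)] by simp
    then show "eventually (\<lambda>y. f y = g y) (at x)"
      using c by (simp add: eventually_cosparse_chart eventually_at_chart)
  qed
  then show ?thesis by (simp add: mero_eq_iff)
qed

lemma surface_meromorphicD:
  "surface_meromorphic f \<Longrightarrow> (U, \<phi>) \<in> atlas \<Longrightarrow> (f \<circ> inv_into U \<phi>) meromorphic_on \<phi> ` U"
  by (auto simp: surface_meromorphic_def)

lemma mero_eq_rep: "mero_eq (rep_mero f) (rep_mero f)"
  using Quotient3_rel_rep[OF Quotient3_mero, of f f] by simp

lemma surface_meromorphic_rep: "surface_meromorphic (rep_mero f)"
  using mero_eq_rep by (rule mero_eqD)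

lemma mero_eq_rep_abs: "surface_meromorphic f \<Longrightarrow> mero_eq (rep_mero (abs_mero f)) f"
  by (rule Quotient3_rep_abs[OF Quotient3_mero]) (simp add: mero_eqI)

lemma rep_mero_eqI: "mero_eq (rep_mero f) (rep_mero g) \<Longrightarrow> f = g"
  using Quotient3_rel_rep[OF Quotient3_mero, of f g] by simp

lemma eventually_deriv_eq:
  fixes f g :: "complex \<Rightarrow> complex"
  assumes "eventually (\<lambda>z. f z = g z) (at w)"
  shows "eventually (\<lambda>z. deriv f z = deriv g z) (at w)"
proof -
  obtain S where S: "open S" "w \<in> S" "\<And>z. z \<in> S \<Longrightarrow> z \<noteq> w \<Longrightarrow> f z = g z"
    using assms by (auto simp: eventually_at_topological)
  have "deriv f z = deriv g z" if "z \<in> S" "z \<noteq> w" for z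
  proof (rule deriv_cong_ev[OF _ refl])
    have "open (S - {w})" using S(1) by auto
    then have "\<forall>\<^sub>F y in nhds z. y \<in> S - {w}" using that by (intro eventually_nhds_in_open) auto
    then show "\<forall>\<^sub>F y in nhds z. f y = g y" by (rule eventually_mono) (use S(3) in auto)
  qed
  then show ?thesis unfolding eventually_at_topological using S(1,2) by blast
qed

lemma lie_deriv_local_transition:
  assumes X: "meromorphic_vector_field X" and f: "surface_meromorphic f"
    and c: "(U, \<phi>) \<in> atlas" "x \<in> U" and d: "(V, \<psi>) \<in> atlas" "x \<in> V"
  shows "remove_sings (\<lambda>z. X (U, \<phi>) z * deriv (f \<circ> inv_into U \<phi>) z) (\<phi> x) =
    remove_sings (\<lambda>z. X (V, \<psi>) z * deriv (f \<circ> inv_into V \<psi>) z) (\<psi> x)"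
proof -
  let ?t = "\<psi> \<circ> inv_into U \<phi>"
  let ?F = "\<lambda>z. X (U, \<phi>) z * deriv (f \<circ> inv_into U \<phi>) z"
  let ?G = "\<lambda>z. X (V, \<psi>) z * deriv (f \<circ> inv_into V \<psi>) z"
  have t: "filtermap ?t (at (\<phi> x)) = at (\<psi> x)"
  proof -
    have "filtermap ?t (at (\<phi> x)) = filtermap \<psi> (filtermap (inv_into U \<phi>) (at (\<phi> x)))"
      by (simp only: filtermap_filtermap o_def)
    then show ?thesis by (simp only: chart_at(2)[OF c] chart_at(1)[OF d])
  qed
  have op: "open (\<phi> ` (U \<inter> V))"
    using chartD(1)[OF c(1)] chartD(1)[OF d(1)] by (simp add: chart_open_iff[OF c(1)] open_Int)
  have x: "\<phi> x \<in> \<phi> ` (U \<inter> V)" using c(2) d(2) by blast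
  have "\<forall>\<^sub>F z in cosparse (\<phi> ` (U \<inter> V)). X (V, \<psi>) (?t z) = deriv ?t z * X (U, \<phi>) z"
    using X c(1) d(1) unfolding meromorphic_vector_field_def by blast
  then have ev1: "\<forall>\<^sub>F z in at (\<phi> x). X (V, \<psi>) (?t z) = deriv ?t z * X (U, \<phi>) z"
    using x by (rule eventually_cosparse_imp_eventually_at)
  have "\<forall>\<^sub>F w in cosparse (\<psi> ` V). (f \<circ> inv_into V \<psi>) analytic_on {w}"
    by (rule meromorphic_on_imp_analytic_cosparse[OF surface_meromorphicD[OF f d(1)]])
  then have "\<forall>\<^sub>F w in at (\<psi> x). (f \<circ> inv_into V \<psi>) analytic_on {w}"
    using d(2) by (auto simp: eventually_cosparse_chart[OF d(1)])
  then have ev2: "\<forall>\<^sub>F z in at (\<phi> x). (f \<circ> inv_into V \<psi>) analytic_on {?t z}"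
    by (simp add: t[symmetric] eventually_filtermap)
  have ev3: "\<forall>\<^sub>F z in at (\<phi> x). z \<in> \<phi> ` (U \<inter> V)"
    by (rule eventually_at_in_open'[OF op x])
  have "\<forall>\<^sub>F z in at (\<phi> x). ?F z = (?G \<circ> ?t) z"
    using ev1 ev2 ev3
  proof eventually_elim
    case (elim z)
    have "?t analytic_on \<phi> ` (U \<inter> V)"
      using chart_transition[OF c(1) d(1)] op by (simp add: analytic_on_open)
    then have "?t analytic_on {z}" using elim(3) by (auto intro: analytic_on_subset)
    then have tz: "?t field_differentiable at z" by (rule analytic_on_imp_differentiable_at) simp
    have fz: "(f \<circ> inv_into V \<psi>) field_differentiable at (?t z)"
      using elim(2) by (rule analytic_on_imp_differentiable_at) simp
    have "\<forall>\<^sub>F y in nhds z. y \<in> \<phi> ` (U \<inter> V)" by (rule eventually_nhds_in_open[OF op elim(3)])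
    then have "\<forall>\<^sub>F y in nhds z. (f \<circ> inv_into U \<phi>) y = ((f \<circ> inv_into V \<psi>) \<circ> ?t) y"
      by (rule eventually_mono) (auto simp: chartD(6)[OF c(1)] chartD(6)[OF d(1)])
    then have "deriv (f \<circ> inv_into U \<phi>) z = deriv ((f \<circ> inv_into V \<psi>) \<circ> ?t) z"
      by (rule deriv_cong_ev) simp
    also have "\<dots> = deriv (f \<circ> inv_into V \<psi>) (?t z) * deriv ?t z"
      by (rule deriv_chain[OF tz fz])
    finally show ?case using elim(1) by simp
  qed
  then have "remove_sings ?F (\<phi> x) = remove_sings (?G \<circ> ?t) (\<phi> x)"
    by (rule remove_sings_cong) simp
  also have "\<dots> = remove_sings ?G (\<psi> x)" by (rule remove_sings_compose[OF t])
  finally show ?thesis .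
qed

lemma lie_deriv_ex:
  assumes X: "meromorphic_vector_field X" and f: "surface_meromorphic f"
  obtains g where "surface_meromorphic g" "\<And>U \<phi>. (U, \<phi>) \<in> atlas \<Longrightarrow> eventually
     (\<lambda>z. (g \<circ> inv_into U \<phi>) z = X (U, \<phi>) z * deriv (f \<circ> inv_into U \<phi>) z) (cosparse (\<phi> ` U))"
proof -
  let ?F = "\<lambda>U \<phi> z. X (U, \<phi>) z * deriv (f \<circ> inv_into U \<phi>) z"
  have "\<exists>c. c \<in> atlas \<and> x \<in> fst c" for x :: 'a by (metis chart_exists fst_conv)
  then obtain C where C: "\<And>x :: 'a. C x \<in> atlas" "\<And>x. x \<in> fst (C x)" by metis
  define g where "g x = remove_sings (?F (fst (C x)) (snd (C x))) (snd (C x) x)" for x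
  have g: "(g \<circ> inv_into U \<phi>) z = remove_sings (?F U \<phi>) z" if c: "(U, \<phi>) \<in> atlas" "z \<in> \<phi> ` U" for U \<phi> z
  proof -
    obtain x where x: "x \<in> U" "z = \<phi> x" using c(2) by auto
    have "g x = remove_sings (?F U \<phi>) (\<phi> x)"
      unfolding g_def
      by (rule lie_deriv_local_transition[OF X f _ _ c(1) x(1)]) (use C[of x] in auto)
    then show ?thesis using x chartD(6)[OF c(1)] by simp
  qed
  have F: "?F U \<phi> meromorphic_on \<phi> ` U" if c: "(U, \<phi>) \<in> atlas" for U \<phi>
  proof (rule meromorphic_on_mult)
    show "X (U, \<phi>) meromorphic_on \<phi> ` U"
      using X c unfolding meromorphic_vector_field_def by blast
    show "deriv (f \<circ> inv_into U \<phi>) meromorphic_on \<phi> ` U"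
      by (rule meromorphic_on_deriv[OF surface_meromorphicD[OF f c]])
  qed
  have ev: "eventually (\<lambda>z. (g \<circ> inv_into U \<phi>) z = ?F U \<phi> z) (cosparse (\<phi> ` U))"
    if c: "(U, \<phi>) \<in> atlas" for U \<phi>
  proof -
    have "eventually (\<lambda>z. remove_sings (?F U \<phi>) z = ?F U \<phi> z) (cosparse (\<phi> ` U))"
      by (rule eventually_remove_sings_eq[OF F[OF c]])
    moreover have "eventually (\<lambda>z. z \<in> \<phi> ` U) (cosparse (\<phi> ` U))"
      by (rule eventually_in_cosparse[OF order_refl chartD(2)[OF c]])
    ultimately show ?thesis
      by eventually_elim (simp only: g[OF c])
  qed
  have "surface_meromorphic g"
    unfolding surface_meromorphic_def
  proof clarify
    fix U and \<phi> :: "'a \<Rightarrow> complex" assume c: "(U, \<phi>) \<in> atlas"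
    have "(g \<circ> inv_into U \<phi>) meromorphic_on \<phi> ` U \<longleftrightarrow> ?F U \<phi> meromorphic_on \<phi> ` U"
      by (rule meromorphic_on_cong[OF _ refl]) (rule eventually_cosparse_imp_eventually_at[OF ev[OF c]])
    then show "(g \<circ> inv_into U \<phi>) meromorphic_on \<phi> ` U" using F[OF c] by simp
  qed
  then show thesis using ev that by blast
qed

lemma lie_deriv_abs:
  assumes f: "surface_meromorphic f" and g: "surface_meromorphic g"
    and fg: "\<And>U \<phi>. (U, \<phi>) \<in> atlas \<Longrightarrow> eventually
     (\<lambda>z. (g \<circ> inv_into U \<phi>) z = X (U, \<phi>) z * deriv (f \<circ> inv_into U \<phi>) z) (cosparse (\<phi> ` U))"
  shows "lie_deriv X (abs_mero f) = abs_mero g"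
  unfolding lie_deriv_def
proof (rule the_equality)
  let ?f = "rep_mero (abs_mero f)" and ?g = "rep_mero (abs_mero g)"
  have ev: "eventually (\<lambda>z. (g \<circ> inv_into U \<phi>) z = X (U, \<phi>) z * deriv (?f \<circ> inv_into U \<phi>) z)
    (cosparse (\<phi> ` U))" if c: "(U, \<phi>) \<in> atlas" for U \<phi>
  proof -
    have "eventually (\<lambda>z. (?f \<circ> inv_into U \<phi>) z = (f \<circ> inv_into U \<phi>) z) (cosparse (\<phi> ` U))"
      using mero_eq_rep_abs[OF f] c by (auto simp: mero_eq_chart)
    then have "eventually (\<lambda>z. deriv (?f \<circ> inv_into U \<phi>) z = deriv (f \<circ> inv_into U \<phi>) z) (cosparse (\<phi> ` U))"
      unfolding eventually_cosparse_chart[OF c] by (blast intro: eventually_deriv_eq)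
    with fg[OF c] show ?thesis by eventually_elim simp
  qed
  show "\<forall>(U, \<phi>)\<in>atlas. eventually
     (\<lambda>z. (?g \<circ> inv_into U \<phi>) z = X (U, \<phi>) z * deriv (?f \<circ> inv_into U \<phi>) z) (cosparse (\<phi> ` U))"
  proof clarify
    fix U and \<phi> :: "'a \<Rightarrow> complex" assume c: "(U, \<phi>) \<in> atlas"
    have "eventually (\<lambda>z. (?g \<circ> inv_into U \<phi>) z = (g \<circ> inv_into U \<phi>) z) (cosparse (\<phi> ` U))"
      using mero_eq_rep_abs[OF g] c by (auto simp: mero_eq_chart)
    with ev[OF c] show "eventually
     (\<lambda>z. (?g \<circ> inv_into U \<phi>) z = X (U, \<phi>) z * deriv (?f \<circ> inv_into U \<phi>) z) (cosparse (\<phi> ` U))"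
      by eventually_elim simp
  qed
  fix h
  assume h: "\<forall>(U, \<phi>)\<in>atlas. eventually
     (\<lambda>z. (rep_mero h \<circ> inv_into U \<phi>) z = X (U, \<phi>) z * deriv (?f \<circ> inv_into U \<phi>) z) (cosparse (\<phi> ` U))"
  have "mero_eq (rep_mero h) g"
    unfolding mero_eq_chart
  proof (intro conjI surface_meromorphic_rep g; clarify)
    fix U and \<phi> :: "'a \<Rightarrow> complex" assume c: "(U, \<phi>) \<in> atlas"
    have "eventually
     (\<lambda>z. (rep_mero h \<circ> inv_into U \<phi>) z = X (U, \<phi>) z * deriv (?f \<circ> inv_into U \<phi>) z) (cosparse (\<phi> ` U))"
      using h c by blast
    with ev[OF c] show "eventually (\<lambda>z. (rep_mero h \<circ> inv_into U \<phi>) z = (g \<circ> inv_into U \<phi>) z) (cosparse (\<phi> ` U))"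
      by eventually_elim simp
  qed
  then show "h = abs_mero g"
    using Quotient3_rel_abs[OF Quotient3_mero] Quotient3_abs_rep[OF Quotient3_mero] by metis
qed

lemma mero_cases: obtains f' where "f = abs_mero f'" "surface_meromorphic f'"
  using Quotient3_abs_rep[OF Quotient3_mero, of f] surface_meromorphic_rep[of f] by metis

lemma lie_deriv_cases:
  assumes X: "meromorphic_vector_field X"
  obtains f' g' where "f = abs_mero f'" "surface_meromorphic f'" "surface_meromorphic g'"
    "lie_deriv X f = abs_mero g'"
    "\<And>U \<phi>. (U, \<phi>) \<in> atlas \<Longrightarrow> eventually
     (\<lambda>z. (g' \<circ> inv_into U \<phi>) z = X (U, \<phi>) z * deriv (f' \<circ> inv_into U \<phi>) z) (cosparse (\<phi> ` U))"
proof -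
  obtain f' where f: "f = abs_mero f'" "surface_meromorphic f'" by (rule mero_cases)
  obtain g' where g: "surface_meromorphic g'" "\<And>U \<phi>. (U, \<phi>) \<in> atlas \<Longrightarrow> eventually
     (\<lambda>z. (g' \<circ> inv_into U \<phi>) z = X (U, \<phi>) z * deriv (f' \<circ> inv_into U \<phi>) z) (cosparse (\<phi> ` U))"
    using lie_deriv_ex[OF X f(2)] by blast
  show thesis
    using that[OF f g(1) _ g(2)] lie_deriv_abs[OF f(2) g] f(1) by simp
qed

lemma derivation_lie_deriv:
  assumes X: "meromorphic_vector_field X"
  shows "derivation (lie_deriv X)"
  unfolding derivation_def
proof (intro conjI allI)
  fix f h
  obtain f' g' where f: "f = abs_mero f'" "surface_meromorphic f'" "surface_meromorphic g'"
    "lie_deriv X f = abs_mero g'"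
    "\<And>U \<phi>. (U, \<phi>) \<in> atlas \<Longrightarrow> eventually
     (\<lambda>z. (g' \<circ> inv_into U \<phi>) z = X (U, \<phi>) z * deriv (f' \<circ> inv_into U \<phi>) z) (cosparse (\<phi> ` U))"
    using lie_deriv_cases[OF X, of f] by blast
  obtain h' k' where h: "h = abs_mero h'" "surface_meromorphic h'" "surface_meromorphic k'"
    "lie_deriv X h = abs_mero k'"
    "\<And>U \<phi>. (U, \<phi>) \<in> atlas \<Longrightarrow> eventually
     (\<lambda>z. (k' \<circ> inv_into U \<phi>) z = X (U, \<phi>) z * deriv (h' \<circ> inv_into U \<phi>) z) (cosparse (\<phi> ` U))"
    using lie_deriv_cases[OF X, of h] by blast
  have abs: "abs_mero a + abs_mero b = abs_mero (\<lambda>x. a x + b x)"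
    "abs_mero a * abs_mero b = abs_mero (\<lambda>x. a x * b x)"
    if "surface_meromorphic a" "surface_meromorphic b" for a b :: "'a \<Rightarrow> complex"
    using that by (auto intro: plus_mero.abs_eq times_mero.abs_eq mero_eqI)
  have an: "\<forall>\<^sub>F z in cosparse (\<phi> ` U). (a \<circ> inv_into U \<phi>) field_differentiable at z"
    if a: "surface_meromorphic a" and c: "(U, \<phi>) \<in> atlas" for a :: "'a \<Rightarrow> complex" and U \<phi>
    using meromorphic_on_imp_analytic_cosparse[OF surface_meromorphicD[OF a c]]
    by (rule eventually_mono) (auto intro: analytic_on_imp_differentiable_at)
  have "lie_deriv X (abs_mero (\<lambda>x. f' x + h' x)) = abs_mero (\<lambda>x. g' x + k' x)"
  proof (rule lie_deriv_abs)
    fix U and \<phi> :: "'a \<Rightarrow> complex" assume c: "(U, \<phi>) \<in> atlas"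
    show "\<forall>\<^sub>F z in cosparse (\<phi> ` U). ((\<lambda>x. g' x + k' x) \<circ> inv_into U \<phi>) z =
      X (U, \<phi>) z * deriv ((\<lambda>x. f' x + h' x) \<circ> inv_into U \<phi>) z"
      using f(5)[OF c] h(5)[OF c] an[OF f(2) c] an[OF h(2) c]
      by eventually_elim (simp add: o_def ring_distribs)
  qed (intro surface_meromorphic_intros f h)+
  then show "lie_deriv X (f + h) = lie_deriv X f + lie_deriv X h"
    using f h by (simp add: abs)
  have "lie_deriv X (abs_mero (\<lambda>x. f' x * h' x)) = abs_mero (\<lambda>x. g' x * h' x + f' x * k' x)"
  proof (rule lie_deriv_abs)
    fix U and \<phi> :: "'a \<Rightarrow> complex" assume c: "(U, \<phi>) \<in> atlas"
    show "\<forall>\<^sub>F z in cosparse (\<phi> ` U). ((\<lambda>x. g' x * h' x + f' x * k' x) \<circ> inv_into U \<phi>) z =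
      X (U, \<phi>) z * deriv ((\<lambda>x. f' x * h' x) \<circ> inv_into U \<phi>) z"
      using f(5)[OF c] h(5)[OF c] an[OF f(2) c] an[OF h(2) c]
      by eventually_elim (simp add: o_def algebra_simps)
  qed (intro surface_meromorphic_intros f h)+
  then show "lie_deriv X (f * h) = lie_deriv X f * h + f * lie_deriv X h"
    using f h by (simp add: abs surface_meromorphic_intros)
qed

lemma lie_deriv_const: "lie_deriv X (mero_const c) = 0"
proof -
  have "lie_deriv X (abs_mero (\<lambda>_. c)) = abs_mero (\<lambda>_. 0)"
    by (rule lie_deriv_abs) (auto simp: o_def surface_meromorphic_const)
  then show ?thesis by (simp add: mero_const.abs_eq zero_mero.abs_eq)
qed

section \<open>Invariant and equivariant operators\<close>

definition mobius_operators :: "'a::riemann_surface mero rdo set" where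
  "mobius_operators =
     {(rdo_const (mero_const a) * rdo_X 0 + rdo_const (mero_const b)) /
      (rdo_const (mero_const c) * rdo_X 0 + rdo_const (mero_const d)) | a b c d. a * d - b * c \<noteq> 0}"

definition invariant_operators :: "'a::riemann_surface vector_field \<Rightarrow> 'a mero rdo set" where
  "invariant_operators X = {R. \<forall>T\<in>mobius_operators.
     rdo_composable (lie_deriv X) R T \<and> rdo_comp (lie_deriv X) R T = R}"

definition equivariant_operators :: "'a::riemann_surface vector_field \<Rightarrow> 'a mero rdo set" where
  "equivariant_operators X = {R. \<forall>T\<in>mobius_operators.
     rdo_composable (lie_deriv X) R T \<and> rdo_composable (lie_deriv X) T R \<and>
     rdo_comp (lie_deriv X) R T = rdo_comp (lie_deriv X) T R}"

definition phi_operator :: "'a::riemann_surface mero rdo" where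
  "phi_operator = - (1 / 2) * (rdo_X 2 / rdo_X 1)"

definition Phi :: "'a::riemann_surface mero rdo \<Rightarrow> 'a mero rdo" where
  "Phi H = rdo_X 0 + rdo_X 1 / (H + phi_operator)"

end

theory Submission
  imports Defs
begin

text \<open>Write \<open>\<Phi> H = X\<^sub>0 + X\<^sub>1 / G\<close> with \<open>G = H + \<phi>\<close>.  Composition with a Moebius transformation \<open>T\<close> is a
  field endomorphism commuting with the derivation (it is everywhere defined because \<open>T\<close> has an
  inverse), and \<open>\<phi> \<circ> T = \<phi> + c X\<^sub>1 / (c X\<^sub>0 + d)\<close>.  Equivariance of \<open>\<Phi> H\<close> amounts to
  \<open>G \<circ> T = G + c X\<^sub>1 / (c X\<^sub>0 + d)\<close>, that is, to invariance of \<open>H = G - \<phi>\<close>.\<close>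

section \<open>Calculus of derivations and generation of the differential polynomials\<close>

lemma derivation_minus:
  assumes "derivation D"
  shows "D (- x) = - D x"
  using derivation_add[OF assms, of x "- x"] by (simp add: derivation_0[OF assms] add_eq_0_iff)

lemma derivation_diff: "derivation D \<Longrightarrow> D (x - y) = D x - D y"
  using derivation_add[of D x "- y"] by (simp add: derivation_minus)

lemma derivation_divide:
  fixes D :: "'f::field \<Rightarrow> 'f"
  assumes D: "derivation D" and y: "y \<noteq> 0"
  shows "D (x / y) = (D x * y - x * D y) / (y * y)"
proof -
  have "D x = D (x / y) * y + x / y * D y"
    using derivation_mult[OF D, of "x / y" y] y by simp
  then show ?thesis using y by (simp add: field_simps)
qed

text \<open>Constants and indeterminates generate the ring of differential polynomials, so a
  property closed under sums and products need only be checked on these. Both the compatibility of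
  substitution with derivation and the associativity of composition are reduced to generators in
  this way.\<close>

lemma diff_poly_induct [case_names const X add mult]:
  fixes P :: "'k::field diff_poly \<Rightarrow> bool"
  assumes const: "\<And>a. P (Poly_Mapping.single 0 a)"
    and X: "\<And>k. P (Poly_Mapping.single (Poly_Mapping.single k 1) 1)"
    and add: "\<And>p q. P p \<Longrightarrow> P q \<Longrightarrow> P (p + q)" and mult: "\<And>p q. P p \<Longrightarrow> P q \<Longrightarrow> P (p * q)"
  shows "P p"
proof -
  have 0: "P 0" and 1: "P 1"
    using const[of 0] const[of 1] by simp_all
  have sum: "P (sum f A)" if "\<And>x. P (f x)" for f and A :: "(nat \<Rightarrow>\<^sub>0 nat) set"
    by (induction A rule: infinite_finite_induct) (simp_all add: 0 add that)
  have prod: "P (prod f A)" if "\<And>x. P (f x)" for f and A :: "nat set"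
    by (induction A rule: infinite_finite_induct) (simp_all add: 1 mult that)
  have power: "P (q ^ n)" if "P q" for q n
    by (induction n) (simp_all add: 1 mult that)
  have monom: "P (Poly_Mapping.single m 1)" for m
    unfolding monomial_prod[of m] by (intro prod power X)
  have "P (Poly_Mapping.single m a)" for m a
    using mult[OF const[of a] monom[of m]] by (simp add: mult_single)
  then have "P (\<Sum>m\<in>Poly_Mapping.keys p. Poly_Mapping.single m (Poly_Mapping.lookup p m))"
    by (intro sum)
  then show ?thesis by (simp only: diff_poly_sum_monomials)
qed

lemma rdo_X_nonzero: "rdo_X k \<noteq> 0"
  by (simp add: rdo_X_def Zero_fract_def eq_fract del: One_nat_def)
    (metis lookup_single_eq lookup_zero zero_neq_one)

lemma rdo_const_eq_0_iff: "rdo_const a = 0 \<longleftrightarrow> a = 0"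
  by (auto simp: rdo_const_def fract_expand eq_fract dest: arg_cong[where f = "\<lambda>p. Poly_Mapping.lookup p 0"])

lemma rdo_const_minus: "rdo_const (- a) = - rdo_const a"
  using rdo_const_hom(3)[of a "- a"] by (simp add: rdo_const_hom(1) add_eq_0_iff)

text \<open>\<open>X\<^sub>0\<close> and \<open>1\<close> are distinct monomials, so both
  coefficients can be read off from the sum. This keeps denominators of Moebius transformations away
  from \<open>0\<close>.\<close>

lemma rdo_linear_nonzero:
  assumes "\<gamma> \<noteq> 0 \<or> \<epsilon> \<noteq> 0"
  shows "rdo_const \<gamma> * rdo_X 0 + rdo_const \<epsilon> \<noteq> 0"
proof
  let ?m = "Poly_Mapping.single 0 1 :: nat \<Rightarrow>\<^sub>0 nat"
  let ?p = "Poly_Mapping.single ?m \<gamma> + Poly_Mapping.single 0 \<epsilon>"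
  assume "rdo_const \<gamma> * rdo_X 0 + rdo_const \<epsilon> = 0"
  then have "Fract ?p 1 = Fract 0 1"
    by (simp add: rdo_const_def rdo_X_def mult_single fract_collapse)
  then have p: "?p = 0" by (simp add: eq_fract)
  have "?m \<noteq> 0" by (metis lookup_single_eq lookup_zero zero_neq_one)
  then have "Poly_Mapping.lookup ?p ?m = \<gamma>" "Poly_Mapping.lookup ?p 0 = \<epsilon>"
    by (simp_all add: lookup_add lookup_single when_def)
  then show False using assms unfolding p by simp
qed

text \<open>The entries lie in the coefficient field, so that the algebra works over any
  differential field; \<open>mobius_operators\<close> is the case of entries
  \<open>mero_const\<close>.\<close>

definition mobius :: "'k::field \<Rightarrow> 'k \<Rightarrow> 'k \<Rightarrow> 'k \<Rightarrow> 'k rdo" where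
  "mobius a b c d = (rdo_const a * rdo_X 0 + rdo_const b) / (rdo_const c * rdo_X 0 + rdo_const d)"

section \<open>Composition of rational differential operators\<close>

context
  fixes \<delta> :: "'k::field \<Rightarrow> 'k"
  assumes derivation: "derivation \<delta>"
begin

lemmas derivation_rdo_deriv = rdo_deriv(1)[OF derivation]

lemma diff_poly_subst_const: "diff_poly_subst \<delta> Q (Poly_Mapping.single 0 a) = rdo_const a"
  by (simp add: diff_poly_subst_single)

lemma diff_poly_subst_X:
  "diff_poly_subst \<delta> Q (Poly_Mapping.single (Poly_Mapping.single k 1) 1) = (rdo_deriv \<delta> ^^ k) Q"
  by (simp add: diff_poly_subst_single rdo_const_hom)

lemma diff_poly_subst_1: "diff_poly_subst \<delta> Q 1 = 1"
  using diff_poly_subst_const[of Q 1] by (simp add: rdo_const_hom)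

lemma diff_poly_subst_0: "diff_poly_subst \<delta> Q 0 = 0"
  by (simp add: diff_poly_subst_def)

lemma diff_poly_subst_diff:
  "diff_poly_subst \<delta> Q (p - q) = diff_poly_subst \<delta> Q p - diff_poly_subst \<delta> Q q"
  using diff_poly_subst_add[of \<delta> Q "p - q" q] by simp

text \<open>Substitution sends \<open>X\<^sub>k\<close> to the \<open>k\<close>-th derivative of
  \<open>Q\<close>, and one more derivation raises the index by one on both sides. Since both sides
  satisfy the same Leibniz rule, agreement on generators suffices.\<close>

lemma rdo_deriv_diff_poly_subst:
  "rdo_deriv \<delta> (diff_poly_subst \<delta> Q p) = diff_poly_subst \<delta> Q (diff_poly_deriv \<delta> p)"
proof (induction p rule: diff_poly_induct)
  case (const a)
  show ?case
    unfolding diff_poly_subst_const diff_poly_deriv_single[OF derivation] monom_deriv_0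
    by (simp add: rdo_deriv[OF derivation] diff_poly_subst_const)
next
  case (X k)
  have "diff_poly_deriv \<delta> (Poly_Mapping.single (Poly_Mapping.single k 1) 1) =
      Poly_Mapping.single (Poly_Mapping.single (Suc k) 1) 1"
    unfolding diff_poly_deriv_single[OF derivation] monom_deriv_X
    by (simp add: derivation_1[OF derivation])
  then show ?case by (simp only: diff_poly_subst_X funpow.simps o_apply)
next
  case (add p q)
  then show ?case
    by (simp add: diff_poly_subst_add derivation_add[OF derivation_rdo_deriv]
        diff_poly_deriv_add[OF derivation])
next
  case (mult p q)
  then show ?case
    by (simp add: diff_poly_subst_add diff_poly_subst_mult derivation_mult[OF derivation_rdo_deriv]
        derivation_mult[OF derivation_diff_poly_deriv[OF derivation]])
qed

text \<open>\<open>X\<^sub>0\<close> is the identity operator: its \<open>k\<close>-th derivative is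
  \<open>X\<^sub>k\<close>.\<close>

lemma diff_poly_subst_X0: "diff_poly_subst \<delta> (rdo_X 0) p = Fract p 1"
proof -
  have "(rdo_deriv \<delta> ^^ k) (rdo_X 0) = rdo_X k" for k
    by (induction k) (simp_all add: rdo_deriv[OF derivation])
  then show ?thesis unfolding Fract_diff_poly diff_poly_subst_def by simp
qed

lemma rdo_composableE:
  assumes "rdo_composable \<delta> R Q"
  obtains p q where "R = Fract p q" "q \<noteq> 0" "diff_poly_subst \<delta> Q q \<noteq> 0"
    "rdo_comp \<delta> R Q = diff_poly_subst \<delta> Q p / diff_poly_subst \<delta> Q q"
  using assms unfolding rdo_composable_def
  by (metis rdo_comp_Fract diff_poly_subst_0)

text \<open>One fraction whose denominator survives the substitution yields both definedness and
  value of the composite; the closure rules below each exhibit such a fraction.\<close>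

lemma rdo_comp_FractI:
  assumes "diff_poly_subst \<delta> Q q \<noteq> 0" "R = Fract p q"
    "S = diff_poly_subst \<delta> Q p / diff_poly_subst \<delta> Q q"
  shows "rdo_composable \<delta> R Q \<and> rdo_comp \<delta> R Q = S"
  using assms rdo_comp_Fract unfolding rdo_composable_def by blast

lemma rdo_comp_poly:
  "rdo_composable \<delta> (Fract p 1) Q \<and> rdo_comp \<delta> (Fract p 1) Q = diff_poly_subst \<delta> Q p"
  by (rule rdo_comp_FractI[of _ 1 _ p]) (simp_all add: diff_poly_subst_1)

lemma rdo_comp_const:
  "rdo_composable \<delta> (rdo_const a) Q \<and> rdo_comp \<delta> (rdo_const a) Q = rdo_const a"
  using rdo_comp_poly[of "Poly_Mapping.single 0 a" Q]
  by (simp only: rdo_const_def[symmetric] diff_poly_subst_const)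

lemma rdo_comp_X:
  "rdo_composable \<delta> (rdo_X k) Q \<and> rdo_comp \<delta> (rdo_X k) Q = (rdo_deriv \<delta> ^^ k) Q"
  using rdo_comp_poly[of "Poly_Mapping.single (Poly_Mapping.single k 1) 1" Q]
  by (simp only: rdo_X_def[symmetric] diff_poly_subst_X)

lemma rdo_comp_add:
  assumes "rdo_composable \<delta> R Q" "rdo_composable \<delta> S Q"
  shows "rdo_composable \<delta> (R + S) Q \<and> rdo_comp \<delta> (R + S) Q = rdo_comp \<delta> R Q + rdo_comp \<delta> S Q"
proof -
  obtain p q where R: "R = Fract p q" "q \<noteq> 0" "diff_poly_subst \<delta> Q q \<noteq> 0"
    "rdo_comp \<delta> R Q = diff_poly_subst \<delta> Q p / diff_poly_subst \<delta> Q q"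
    by (rule rdo_composableE[OF assms(1)])
  obtain r s where S: "S = Fract r s" "s \<noteq> 0" "diff_poly_subst \<delta> Q s \<noteq> 0"
    "rdo_comp \<delta> S Q = diff_poly_subst \<delta> Q r / diff_poly_subst \<delta> Q s"
    by (rule rdo_composableE[OF assms(2)])
  show ?thesis unfolding R(4) S(4)
    by (rule rdo_comp_FractI[of _ "q * s" _ "p * s + r * q"])
      (use R S in \<open>simp_all add: diff_poly_subst_mult diff_poly_subst_add add_frac_eq\<close>)
qed

lemma rdo_comp_mult:
  assumes "rdo_composable \<delta> R Q" "rdo_composable \<delta> S Q"
  shows "rdo_composable \<delta> (R * S) Q \<and> rdo_comp \<delta> (R * S) Q = rdo_comp \<delta> R Q * rdo_comp \<delta> S Q"
proof -
  obtain p q where R: "R = Fract p q" "q \<noteq> 0" "diff_poly_subst \<delta> Q q \<noteq> 0"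
    "rdo_comp \<delta> R Q = diff_poly_subst \<delta> Q p / diff_poly_subst \<delta> Q q"
    by (rule rdo_composableE[OF assms(1)])
  obtain r s where S: "S = Fract r s" "s \<noteq> 0" "diff_poly_subst \<delta> Q s \<noteq> 0"
    "rdo_comp \<delta> S Q = diff_poly_subst \<delta> Q r / diff_poly_subst \<delta> Q s"
    by (rule rdo_composableE[OF assms(2)])
  show ?thesis unfolding R(4) S(4)
    by (rule rdo_comp_FractI[of _ "q * s" _ "p * r"])
      (use R S in \<open>simp_all add: diff_poly_subst_mult\<close>)
qed

text \<open>The numerator of \<open>S\<close> becomes part of the new denominator; it survives the
  substitution because the composite of \<open>S\<close> is nonzero.\<close>

lemma rdo_comp_divide:
  assumes "rdo_composable \<delta> R Q" "rdo_composable \<delta> S Q" "rdo_comp \<delta> S Q \<noteq> 0"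
  shows "rdo_composable \<delta> (R / S) Q \<and> rdo_comp \<delta> (R / S) Q = rdo_comp \<delta> R Q / rdo_comp \<delta> S Q"
proof -
  obtain p q where R: "R = Fract p q" "q \<noteq> 0" "diff_poly_subst \<delta> Q q \<noteq> 0"
    "rdo_comp \<delta> R Q = diff_poly_subst \<delta> Q p / diff_poly_subst \<delta> Q q"
    by (rule rdo_composableE[OF assms(1)])
  obtain r s where S: "S = Fract r s" "s \<noteq> 0" "diff_poly_subst \<delta> Q s \<noteq> 0"
    "rdo_comp \<delta> S Q = diff_poly_subst \<delta> Q r / diff_poly_subst \<delta> Q s"
    by (rule rdo_composableE[OF assms(2)])
  have "diff_poly_subst \<delta> Q r \<noteq> 0" using assms(3) S(4) by auto
  then show ?thesis unfolding R(4) S(4)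
    by (intro rdo_comp_FractI[of _ "q * r" _ "p * s"])
      (use R S in \<open>simp_all add: diff_poly_subst_mult\<close>)
qed

text \<open>The quotient rule reduces this to numerators and denominators, where substitution
  commutes with derivation.\<close>

lemma rdo_comp_deriv:
  assumes "rdo_composable \<delta> R Q"
  shows "rdo_composable \<delta> (rdo_deriv \<delta> R) Q \<and>
    rdo_comp \<delta> (rdo_deriv \<delta> R) Q = rdo_deriv \<delta> (rdo_comp \<delta> R Q)"
proof -
  let ?d = "diff_poly_deriv \<delta>"
  obtain p q where R: "R = Fract p q" "q \<noteq> 0" "diff_poly_subst \<delta> Q q \<noteq> 0"
    "rdo_comp \<delta> R Q = diff_poly_subst \<delta> Q p / diff_poly_subst \<delta> Q q"
    by (rule rdo_composableE[OF assms(1)])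
  \<comment> \<open>Substituting \<open>X\<^sub>0\<close> is the embedding into the fraction field,
    so the commutation rule at \<open>X\<^sub>0\<close> computes the derivation on
    polynomials.\<close>
  have poly: "rdo_deriv \<delta> (Fract r 1) = Fract (?d r) 1" for r
    using rdo_deriv_diff_poly_subst[of "rdo_X 0" r] by (simp only: diff_poly_subst_X0)
  have q: "Fract q 1 \<noteq> 0" using R(2) by (simp add: fract_expand eq_fract)
  have "R = Fract p 1 / Fract q 1" using R by simp
  then have "rdo_deriv \<delta> R = Fract (?d p * q - p * ?d q) (q * q)"
    by (simp only: derivation_divide[OF derivation_rdo_deriv q] poly) (simp add: R(2))
  then show ?thesis unfolding R(4)
    by (intro rdo_comp_FractI[of _ "q * q" _ "?d p * q - p * ?d q"])
      (use R in \<open>simp_all add: derivation_divide[OF derivation_rdo_deriv] rdo_deriv_diff_poly_subst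
          diff_poly_subst_mult diff_poly_subst_diff\<close>)
qed

text \<open>Associativity of composition with a polynomial as the outermost operator.\<close>

lemma rdo_comp_diff_poly_subst:
  assumes Q: "rdo_composable \<delta> Q S"
  shows "rdo_composable \<delta> (diff_poly_subst \<delta> Q p) S \<and>
    rdo_comp \<delta> (diff_poly_subst \<delta> Q p) S = diff_poly_subst \<delta> (rdo_comp \<delta> Q S) p"
proof (induction p rule: diff_poly_induct)
  case (const a)
  show ?case by (simp add: diff_poly_subst_const rdo_comp_const)
next
  case (X k)
  have "rdo_composable \<delta> ((rdo_deriv \<delta> ^^ k) Q) S \<and>
      rdo_comp \<delta> ((rdo_deriv \<delta> ^^ k) Q) S = (rdo_deriv \<delta> ^^ k) (rdo_comp \<delta> Q S)"
    by (induction k) (simp_all add: Q rdo_comp_deriv)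
  then show ?case by (simp only: diff_poly_subst_X)
qed (simp_all add: diff_poly_subst_add diff_poly_subst_mult rdo_comp_add rdo_comp_mult)

text \<open>If \<open>p\<close> composed with \<open>Q\<close> vanished, composing further with
  \<open>S\<close> would give \<open>0\<close> on one side and, by associativity, \<open>p\<close>
  itself on the other.\<close>

lemma diff_poly_subst_left_inverse:
  assumes "rdo_composable \<delta> Q S" "rdo_comp \<delta> Q S = rdo_X 0" "p \<noteq> 0"
  shows "diff_poly_subst \<delta> Q p \<noteq> 0"
proof
  assume "diff_poly_subst \<delta> Q p = 0"
  then have "rdo_comp \<delta> 0 S = Fract p 1"
    using rdo_comp_diff_poly_subst[OF assms(1), of p] assms(2) by (simp add: diff_poly_subst_X0)
  then have "Fract p 1 = 0" using rdo_comp_const[of 0 S] by (simp add: rdo_const_hom)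
  then show False using assms(3) by (simp add: fract_expand eq_fract)
qed

section \<open>Moebius transformations\<close>

lemma rdo_comp_linear:
  "rdo_composable \<delta> (rdo_const a * rdo_X 0 + rdo_const b) Q \<and>
   rdo_comp \<delta> (rdo_const a * rdo_X 0 + rdo_const b) Q = rdo_const a * Q + rdo_const b"
  by (simp add: rdo_comp_add rdo_comp_mult rdo_comp_const rdo_comp_X)

lemma rdo_comp_mobius:
  assumes "rdo_const c * R + rdo_const d \<noteq> 0"
  shows "rdo_composable \<delta> (mobius a b c d) R \<and> rdo_comp \<delta> (mobius a b c d) R =
    (rdo_const a * R + rdo_const b) / (rdo_const c * R + rdo_const d)"
  using assms by (simp add: mobius_def rdo_comp_divide rdo_comp_linear)

context
  fixes a b c d :: 'k
  assumes det: "a * d - b * c \<noteq> 0"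
begin

lemma rdo_const_det: "rdo_const a * rdo_const d - rdo_const b * rdo_const c \<noteq> 0"
proof -
  have "rdo_const (a * d + - (b * c)) \<noteq> 0" using det by (simp add: rdo_const_eq_0_iff)
  then show ?thesis by (simp only: rdo_const_hom rdo_const_minus) simp
qed

lemma mobius_denom_nonzero: "rdo_const c * rdo_X 0 + rdo_const d \<noteq> 0"
  by (rule rdo_linear_nonzero) (use det in auto)

text \<open>Composability only provides some representing fraction, so the given denominator needs
  an argument. If it vanished at \<open>R\<close>, multiplying the transformation by it would show
  that the numerator vanishes at \<open>R\<close> too; eliminating \<open>R\<close> from the two
  linear equations then contradicts the nonzero determinant.\<close>

lemma rdo_composable_mobiusD:
  assumes "rdo_composable \<delta> (mobius a b c d) R"
  shows "rdo_const c * R + rdo_const d \<noteq> 0"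
proof
  let ?u = "rdo_const c * rdo_X 0 + rdo_const d"
  assume 0: "rdo_const c * R + rdo_const d = 0"
  have "rdo_comp \<delta> (mobius a b c d * ?u) R = 0"
    using rdo_comp_mult[OF assms, of ?u] rdo_comp_linear[of c d R] 0 by simp
  then have 1: "rdo_const a * R + rdo_const b = 0"
    using rdo_comp_linear[of a b R] mobius_denom_nonzero by (simp add: mobius_def)
  have "rdo_const a * rdo_const d - rdo_const b * rdo_const c =
      rdo_const a * (rdo_const c * R + rdo_const d) - rdo_const c * (rdo_const a * R + rdo_const b)"
    by (simp add: algebra_simps)
  then show False using rdo_const_det 0 1 by simp
qed

text \<open>The inverse is given by the adjugate matrix; the determinant \<open>?e\<close> appears
  as a common factor of numerator and denominator and cancels.\<close>

lemma mobius_left_inverse: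
  "rdo_composable \<delta> (mobius a b c d) (mobius d (- b) (- c) a) \<and>
   rdo_comp \<delta> (mobius a b c d) (mobius d (- b) (- c) a) = rdo_X 0"
proof -
  let ?S = "mobius d (- b) (- c) a"
  let ?v = "- (rdo_const c * rdo_X 0) + rdo_const a"
  have "- c \<noteq> 0 \<or> a \<noteq> 0" using det by auto
  then have v: "?v \<noteq> 0"
    using rdo_linear_nonzero[of "- c" a] unfolding rdo_const_minus mult_minus_left by blast
  have S: "?S = (rdo_const d * rdo_X 0 - rdo_const b) / ?v"
    by (simp add: mobius_def rdo_const_minus)
  let ?e = "rdo_const a * rdo_const d - rdo_const b * rdo_const c"
  have den: "rdo_const c * ?S + rdo_const d = ?e / ?v"
    using v unfolding S by (simp add: divide_simps) (simp add: algebra_simps)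
  have num: "rdo_const a * ?S + rdo_const b = ?e * rdo_X 0 / ?v"
    using v unfolding S by (simp add: divide_simps) (simp add: algebra_simps)
  have "rdo_const c * ?S + rdo_const d \<noteq> 0"
    unfolding den using v rdo_const_det by simp
  from rdo_comp_mobius[OF this, of a b] show ?thesis
    unfolding den num using v rdo_const_det by simp
qed

text \<open>Invertibility makes substitution injective. Composition on the right with a Moebius
  transformation is therefore total and an injective field endomorphism.\<close>

lemma diff_poly_subst_mobius: "p \<noteq> 0 \<Longrightarrow> diff_poly_subst \<delta> (mobius a b c d) p \<noteq> 0"
  using mobius_left_inverse diff_poly_subst_left_inverse by blast

lemma composable_mobius: "rdo_composable \<delta> R (mobius a b c d)"
  unfolding rdo_composable_def using diff_poly_subst_mobius by (metis Fract_cases)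

lemma comp_mobius_eq_0_iff: "rdo_comp \<delta> R (mobius a b c d) = 0 \<longleftrightarrow> R = 0"
proof -
  obtain p q where R: "R = Fract p q" "q \<noteq> 0" by (cases R)
  have "R = 0 \<longleftrightarrow> p = 0" using R by (simp add: Zero_fract_def eq_fract)
  then show ?thesis
    using R diff_poly_subst_mobius[of p] diff_poly_subst_mobius[of q]
    by (auto simp: rdo_comp_Fract diff_poly_subst_0)
qed

lemma comp_mobius_hom:
  "rdo_comp \<delta> (R + S) (mobius a b c d) = rdo_comp \<delta> R (mobius a b c d) + rdo_comp \<delta> S (mobius a b c d)"
  "rdo_comp \<delta> (R * S) (mobius a b c d) = rdo_comp \<delta> R (mobius a b c d) * rdo_comp \<delta> S (mobius a b c d)"
  using rdo_comp_add rdo_comp_mult composable_mobius by blast+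

lemma comp_mobius_1: "rdo_comp \<delta> 1 (mobius a b c d) = 1"
  using rdo_comp_const[of 1] by (simp add: rdo_const_hom)

lemma comp_mobius_minus: "rdo_comp \<delta> (- R) (mobius a b c d) = - rdo_comp \<delta> R (mobius a b c d)"
  using comp_mobius_hom(1)[of R "- R"] comp_mobius_eq_0_iff[of 0] by (simp add: add_eq_0_iff)

lemma comp_mobius_divide:
  "rdo_comp \<delta> (R / S) (mobius a b c d) = rdo_comp \<delta> R (mobius a b c d) / rdo_comp \<delta> S (mobius a b c d)"
\<comment> \<open>For \<open>S = 0\<close> both quotients take the default value \<open>0\<close> of
  division by zero.\<close>
proof (cases "S = 0")
  case False
  then show ?thesis using rdo_comp_divide composable_mobius comp_mobius_eq_0_iff by blast
qed (simp add: comp_mobius_eq_0_iff[THEN iffD2])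

section \<open>Moebius transformations with entries annihilated by the derivation\<close>

context
  assumes constants: "\<delta> a = 0" "\<delta> b = 0" "\<delta> c = 0" "\<delta> d = 0"
begin

lemma rdo_deriv_linear:
  "rdo_deriv \<delta> (rdo_const a * rdo_X 0 + rdo_const b) = rdo_const a * rdo_X 1"
  "rdo_deriv \<delta> (rdo_const c * rdo_X 0 + rdo_const d) = rdo_const c * rdo_X 1"
  by (simp_all add: derivation_add[OF derivation_rdo_deriv] derivation_mult[OF derivation_rdo_deriv]
      rdo_deriv[OF derivation] constants
      rdo_const_hom)

lemma rdo_deriv_mobius:
  "rdo_deriv \<delta> (mobius a b c d) = (rdo_const a * rdo_const d - rdo_const b * rdo_const c) *
     rdo_X 1 / (rdo_const c * rdo_X 0 + rdo_const d)\<^sup>2"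
  unfolding mobius_def derivation_divide[OF derivation_rdo_deriv mobius_denom_nonzero] rdo_deriv_linear
  by (simp add: power2_eq_square algebra_simps)

text \<open>This is the logarithmic derivative of \<open>?e * rdo_X 1 / u\<^sup>2\<close>: the
  constant determinant contributes nothing, \<open>rdo_X 1\<close> the first term, and the square in
  the denominator the factor \<open>-2\<close>.\<close>

lemma rdo_deriv2_mobius:
  "rdo_deriv \<delta> (rdo_deriv \<delta> (mobius a b c d)) / rdo_deriv \<delta> (mobius a b c d) =
     rdo_X 2 / rdo_X 1 - 2 * (rdo_const c * rdo_X 1 / (rdo_const c * rdo_X 0 + rdo_const d))"
proof -
  let ?e = "rdo_const a * rdo_const d - rdo_const b * rdo_const c"
  define u where "u = rdo_const c * rdo_X 0 + rdo_const d"
  have u: "u \<noteq> 0" using mobius_denom_nonzero by (simp add: u_def)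
  have e: "rdo_deriv \<delta> ?e = 0"
    by (simp add: derivation_diff[OF derivation_rdo_deriv] derivation_mult[OF derivation_rdo_deriv]
      rdo_deriv[OF derivation] constants
        rdo_const_hom)
  have u2: "rdo_deriv \<delta> (u\<^sup>2) = 2 * u * (rdo_const c * rdo_X 1)"
    using rdo_deriv_linear(2) unfolding u_def[symmetric]
    by (simp add: power2_eq_square derivation_mult[OF derivation_rdo_deriv])
  have X2: "rdo_deriv \<delta> (rdo_X 1) = rdo_X 2"
    using rdo_deriv(3)[OF derivation, of 1] by (simp add: numeral_2_eq_2)
  have "rdo_deriv \<delta> (rdo_deriv \<delta> (mobius a b c d)) =
      (?e * rdo_X 2 * u\<^sup>2 - ?e * rdo_X 1 * (2 * u * (rdo_const c * rdo_X 1))) / (u\<^sup>2 * u\<^sup>2)"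
    unfolding rdo_deriv_mobius u_def[symmetric]
    by (subst derivation_divide[OF derivation_rdo_deriv])
      (use u in \<open>simp_all add: derivation_mult[OF derivation_rdo_deriv] e u2 X2[simplified]\<close>)
  also have "\<dots> = ?e * rdo_X 1 / u\<^sup>2 * (rdo_X 2 / rdo_X 1 - 2 * (rdo_const c * rdo_X 1 / u))"
    using u rdo_X_nonzero[of 1, where 'a = 'k] by (simp add: field_simps power2_eq_square)
  finally show ?thesis
    unfolding rdo_deriv_mobius u_def[symmetric] using u rdo_const_det rdo_X_nonzero[of 1, where 'a = 'k]
    by simp
qed

text \<open>Composing \<open>X\<^sub>1\<close> and \<open>X\<^sub>2\<close> with the transformation
  gives its first and second derivatives. The factor \<open>-1/2\<close> normalises the correction
  in \<open>rdo_deriv2_mobius\<close> to coefficient one.\<close>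

lemma comp_mobius_phi:
  assumes "(2 :: 'k rdo) \<noteq> 0"
  shows "rdo_comp \<delta> (- (1 / 2) * (rdo_X 2 / rdo_X 1)) (mobius a b c d) = - (1 / 2) * (rdo_X 2 / rdo_X 1) +
     rdo_const c * rdo_X 1 / (rdo_const c * rdo_X 0 + rdo_const d)"
proof -
  let ?T = "mobius a b c d"
  have two: "rdo_comp \<delta> 2 ?T = 2"
    using comp_mobius_hom(1)[of 1 1] by (simp add: comp_mobius_1)
  have "rdo_comp \<delta> (rdo_X 1) ?T = rdo_deriv \<delta> ?T" "rdo_comp \<delta> (rdo_X 2) ?T = rdo_deriv \<delta> (rdo_deriv \<delta> ?T)"
    using rdo_comp_X[of _ ?T] by (simp_all add: numeral_2_eq_2)
  then have "rdo_comp \<delta> (- (1 / 2) * (rdo_X 2 / rdo_X 1)) ?T =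
      - (1 / 2) * (rdo_deriv \<delta> (rdo_deriv \<delta> ?T) / rdo_deriv \<delta> ?T)"
    by (simp only: comp_mobius_hom comp_mobius_minus comp_mobius_divide comp_mobius_1 two)
  then show ?thesis
    unfolding rdo_deriv2_mobius using assms by (simp add: right_diff_distrib)
qed

lemma equivariantI:
  assumes G: "G \<noteq> 0" and GT: "rdo_comp \<delta> G (mobius a b c d) =
      G + rdo_const c * rdo_X 1 / (rdo_const c * rdo_X 0 + rdo_const d)"
  defines "R \<equiv> rdo_X 0 + rdo_X 1 / G"
  shows "rdo_composable \<delta> (mobius a b c d) R"
    "rdo_comp \<delta> R (mobius a b c d) = rdo_comp \<delta> (mobius a b c d) R"
proof -
  define u where "u = rdo_const c * rdo_X 0 + rdo_const d"
  \<comment> \<open>\<open>w\<close> is the common numerator of the composite of \<open>G\<close>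
    with the transformation, \<open>w / u\<close>, and of \<open>cR + d\<close>,
    \<open>w / G\<close>.\<close>
  define w where "w = u * G + rdo_const c * rdo_X 1"
  let ?T = "mobius a b c d"
  have u: "u \<noteq> 0" using mobius_denom_nonzero by (simp add: u_def)
  have GT': "rdo_comp \<delta> G ?T = w / u"
    using u unfolding GT u_def[symmetric] w_def by (simp add: field_simps)
  \<comment> \<open>Composition with the transformation is injective and \<open>G\<close> is
    nonzero.\<close>
  then have w: "w \<noteq> 0" using G comp_mobius_eq_0_iff by force
  have den: "rdo_const c * R + rdo_const d = w / G"
    using G unfolding R_def w_def u_def by (simp add: field_simps)
  then have "rdo_const c * R + rdo_const d \<noteq> 0" using w G by simp
  note TR = rdo_comp_mobius[OF this, of a b]
  then show "rdo_composable \<delta> ?T R" by blast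
  have "rdo_comp \<delta> R ?T = ?T + rdo_deriv \<delta> ?T / (w / u)"
    using rdo_comp_X[of 0 ?T] rdo_comp_X[of 1 ?T]
    by (simp add: R_def comp_mobius_hom comp_mobius_divide GT')
  also have "\<dots> = (rdo_const a * rdo_X 0 + rdo_const b) / u +
      (rdo_const a * rdo_const d - rdo_const b * rdo_const c) * rdo_X 1 / (u * w)"
    using u w unfolding rdo_deriv_mobius unfolding mobius_def u_def[symmetric]
    by (simp add: power2_eq_square)
  also have "\<dots> = ((rdo_const a * rdo_X 0 + rdo_const b) * w +
      (rdo_const a * rdo_const d - rdo_const b * rdo_const c) * rdo_X 1) / (u * w)"
    using u w by (simp add: add_divide_distrib)
  \<comment> \<open>After expanding \<open>w\<close>, the terms in \<open>bc\<close> cancel and the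
    multiples of \<open>X\<^sub>1\<close> collect to \<open>a * u * X\<^sub>1\<close>, so
    \<open>u\<close> factors out.\<close>
  also have "(rdo_const a * rdo_X 0 + rdo_const b) * w +
      (rdo_const a * rdo_const d - rdo_const b * rdo_const c) * rdo_X 1 =
      u * ((rdo_const a * rdo_X 0 + rdo_const b) * G + rdo_const a * rdo_X 1)"
    by (simp add: w_def u_def algebra_simps)
  also have "\<dots> / (u * w) = (rdo_const a * R + rdo_const b) / (w / G)"
    using u w G by (simp add: R_def field_simps)
  finally show "rdo_comp \<delta> R ?T = rdo_comp \<delta> ?T R"
    using TR den by simp
qed

text \<open>Solving \<open>R = X\<^sub>0 + X\<^sub>1 / G\<close> for \<open>G\<close> gives
  \<open>X\<^sub>1 / (R - X\<^sub>0)\<close>. Its transformation law comes from dividing the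
  derivative of the transformation by the difference of its values at \<open>R\<close> and
  \<open>X\<^sub>0\<close>.\<close>

lemma equivariantD:
  assumes R: "rdo_composable \<delta> (mobius a b c d) R" "R \<noteq> rdo_X 0"
    and eq: "rdo_comp \<delta> R (mobius a b c d) = rdo_comp \<delta> (mobius a b c d) R"
  shows "rdo_comp \<delta> (rdo_X 1 / (R - rdo_X 0)) (mobius a b c d) =
      rdo_X 1 / (R - rdo_X 0) + rdo_const c * rdo_X 1 / (rdo_const c * rdo_X 0 + rdo_const d)"
proof -
  let ?T = "mobius a b c d"
  let ?e = "rdo_const a * rdo_const d - rdo_const b * rdo_const c"
  define u where "u = rdo_const c * rdo_X 0 + rdo_const d"
  define v where "v = rdo_const c * R + rdo_const d"
  have u: "u \<noteq> 0" using mobius_denom_nonzero by (simp add: u_def)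
  have v: "v \<noteq> 0" using rdo_composable_mobiusD[OF R(1)] by (simp add: v_def)
  have RT: "rdo_comp \<delta> R ?T = (rdo_const a * R + rdo_const b) / v"
    using eq rdo_comp_mobius[of c R d a b] v by (simp add: v_def)
  have "rdo_comp \<delta> (R - rdo_X 0) ?T = rdo_comp \<delta> R ?T - ?T"
    using comp_mobius_hom(1)[of R "- rdo_X 0"] rdo_comp_X[of 0 ?T] by (simp add: comp_mobius_minus)
  also have "\<dots> = ((rdo_const a * R + rdo_const b) * u - (rdo_const a * rdo_X 0 + rdo_const b) * v) / (v * u)"
    using u v unfolding RT by (simp add: mobius_def flip: u_def) (simp add: diff_frac_eq)
  \<comment> \<open>The classical difference formula: two values of a Moebius transformation differ
    by the determinant times the difference of the arguments, over the product of the
    denominators.\<close>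
  also have "(rdo_const a * R + rdo_const b) * u - (rdo_const a * rdo_X 0 + rdo_const b) * v =
      ?e * (R - rdo_X 0)"
    by (simp add: u_def v_def algebra_simps)
  finally have "rdo_comp \<delta> (rdo_X 1 / (R - rdo_X 0)) ?T =
      (?e * rdo_X 1 / u\<^sup>2) / (?e * (R - rdo_X 0) / (v * u))"
    using rdo_comp_X[of 1 ?T] by (simp add: comp_mobius_divide rdo_deriv_mobius u_def)
  also have "\<dots> = rdo_X 1 * v / ((R - rdo_X 0) * u)"
    using u v rdo_const_det R(2) by (simp add: divide_simps power2_eq_square)
  \<comment> \<open>Splitting \<open>v\<close> in this way separates the original quotient from the
    correction term.\<close>
  also have "v = u + rdo_const c * (R - rdo_X 0)"
    by (simp add: u_def v_def algebra_simps)
  also have "rdo_X 1 * \<dots> / ((R - rdo_X 0) * u) = rdo_X 1 / (R - rdo_X 0) + rdo_const c * rdo_X 1 / u"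
    using u R(2) by (simp add: field_simps)
  finally show ?thesis by (simp add: u_def)
qed

end
end
end

section \<open>Meromorphic coefficients\<close>

lemma mero_const_arith:
  "mero_const 0 = 0" "mero_const 1 = 1" "mero_const (x + y) = mero_const x + mero_const y"
  "mero_const (x - y) = mero_const x - mero_const y" "mero_const (x * y) = mero_const x * mero_const y"
  by (transfer; simp add: mero_eqI surface_meromorphic_const)+

lemma mero_const_eq_0_iff: "mero_const x = 0 \<longleftrightarrow> x = 0"
proof
  assume "mero_const x = (0 :: 'a mero)"
  then have "mero_const (x * inverse x) = (0 :: 'a mero)" by (simp add: mero_const_arith)
  then show "x = 0" by (cases "x = 0") (simp_all add: mero_const_arith)
qed (simp add: mero_const_arith)

text \<open>The number \<open>2\<close> is the image of the complex constant \<open>2\<close> under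
  two injective embeddings.\<close>

lemma mero_rdo_two_nonzero: "(2 :: 'a::riemann_surface mero rdo) \<noteq> 0"
proof -
  have "rdo_const (mero_const (1 + 1) :: 'a mero) = 1 + 1"
    by (simp only: mero_const_arith rdo_const_hom)
  then show ?thesis using mero_const_eq_0_iff[of 2] rdo_const_eq_0_iff by (metis one_add_one zero_neq_numeral)
qed

section \<open>The bijection between invariant and equivariant operators\<close>

theorem theorem7:
  fixes X :: "'a::riemann_surface vector_field"
  assumes "meromorphic_vector_field X" and "\<not> zero_vector_field X"
  shows "bij_betw Phi (invariant_operators X) (equivariant_operators X - {rdo_X 0})"
proof -
  let ?\<delta> = "lie_deriv X"
  let ?M = "\<lambda>a b c d. mobius (mero_const a) (mero_const b) (mero_const c) (mero_const d :: 'a mero)"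
  \<comment> \<open>The cocycle measuring the failure of \<open>phi_operator\<close> to be
    invariant.\<close>
  let ?\<mu> = "\<lambda>c d. rdo_const (mero_const c) * rdo_X 1 /
      (rdo_const (mero_const c) * rdo_X 0 + rdo_const (mero_const d :: 'a mero))"
  have \<delta>: "derivation ?\<delta>" by (rule derivation_lie_deriv[OF assms(1)])
  have det: "mero_const a * mero_const d - mero_const b * mero_const c \<noteq> (0 :: 'a mero)"
    if "a * d - b * c \<noteq> 0" for a b c d
    using that mero_const_eq_0_iff[of "a * d - b * c"] by (simp add: mero_const_arith)
  note const = lie_deriv_const[of X]
  note hom = comp_mobius_hom[OF \<delta> det] comp_mobius_minus[OF \<delta> det]
  note composable = composable_mobius[OF \<delta> det]
  have mobius: "mobius_operators = {?M a b c d | a b c d. a * d - b * c \<noteq> 0}"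
    by (simp add: mobius_operators_def mobius_def)
  have phi: "rdo_comp ?\<delta> phi_operator (?M a b c d) = phi_operator + ?\<mu> c d"
    if "a * d - b * c \<noteq> 0" for a b c d
    unfolding phi_operator_def
    by (rule comp_mobius_phi[OF \<delta> det[OF that] const const const const mero_rdo_two_nonzero])
  \<comment> \<open>Since \<open>phi_operator\<close> picks up exactly the cocycle, \<open>H\<close>
    is fixed precisely when \<open>H + phi_operator\<close> picks up the same cocycle.\<close>
  have inv: "H \<in> invariant_operators X \<longleftrightarrow> (\<forall>a b c d. a * d - b * c \<noteq> 0 \<longrightarrow>
      rdo_comp ?\<delta> (H + phi_operator) (?M a b c d) = H + phi_operator + ?\<mu> c d)" for H
    unfolding invariant_operators_def mobius using composable
    by (auto simp: hom phi) (metis add_right_cancel)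
  \<comment> \<open>This keeps \<open>Phi H\<close> away from division by zero, which would return
    \<open>X\<^sub>0\<close>.\<close>
  have nonzero: "H + phi_operator \<noteq> 0" if "H \<in> invariant_operators X" for H
  proof
    assume 0: "H + phi_operator = 0"
    \<comment> \<open>The inversion \<open>1 / X\<^sub>0\<close> has the nonzero cocycle
      \<open>X\<^sub>1 / X\<^sub>0\<close>, whereas the zero operator composes to zero.\<close>
    have "rdo_comp ?\<delta> (H + phi_operator) (?M 0 1 1 0) = H + phi_operator + ?\<mu> 1 0"
      using that inv by simp
    moreover have "rdo_comp ?\<delta> 0 (?M 0 1 1 0) = 0"
      using comp_mobius_eq_0_iff[OF \<delta> det[of 0 0 1 1]] by simp
    ultimately show False
      unfolding 0 by (simp add: mero_const_arith rdo_const_hom rdo_X_nonzero)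
  qed
  show ?thesis
  \<comment> \<open>The witness solves \<open>R = X\<^sub>0 + X\<^sub>1 / (H + phi_operator)\<close>
    for \<open>H\<close>.\<close>
  proof (rule bij_betw_byWitness[where f' = "\<lambda>R. rdo_X 1 / (R - rdo_X 0) - phi_operator"])
    show "\<forall>H\<in>invariant_operators X. rdo_X 1 / (Phi H - rdo_X 0) - phi_operator = H"
      using nonzero by (simp add: Phi_def rdo_X_nonzero)
    show "\<forall>R\<in>equivariant_operators X - {rdo_X 0}. Phi (rdo_X 1 / (R - rdo_X 0) - phi_operator) = R"
      by (simp add: Phi_def rdo_X_nonzero)
    show "Phi ` invariant_operators X \<subseteq> equivariant_operators X - {rdo_X 0}"
    proof (rule image_subsetI)
      fix H assume H: "H \<in> invariant_operators X"
      note G = nonzero[OF H]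
      have "Phi H \<noteq> rdo_X 0" using G by (simp add: Phi_def rdo_X_nonzero)
      moreover have "rdo_composable ?\<delta> (?M a b c d) (Phi H) \<and>
          rdo_comp ?\<delta> (Phi H) (?M a b c d) = rdo_comp ?\<delta> (?M a b c d) (Phi H)"
        if "a * d - b * c \<noteq> 0" for a b c d
        unfolding Phi_def using H that inv
        by (intro conjI equivariantI[OF \<delta> det[OF that] const const const const G]) blast+
      ultimately show "Phi H \<in> equivariant_operators X - {rdo_X 0}"
        unfolding equivariant_operators_def mobius using composable by auto
    qed
    show "(\<lambda>R. rdo_X 1 / (R - rdo_X 0) - phi_operator) ` (equivariant_operators X - {rdo_X 0})
        \<subseteq> invariant_operators X"
    proof (rule image_subsetI)
      fix R assume R: "R \<in> equivariant_operators X - {rdo_X 0}"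
      have "rdo_comp ?\<delta> (rdo_X 1 / (R - rdo_X 0)) (?M a b c d) = rdo_X 1 / (R - rdo_X 0) + ?\<mu> c d"
        if "a * d - b * c \<noteq> 0" for a b c d
        by (rule equivariantD[OF \<delta> det[OF that] const const const const])
          (use R that in \<open>unfold equivariant_operators_def mobius, blast+\<close>)
      then show "rdo_X 1 / (R - rdo_X 0) - phi_operator \<in> invariant_operators X"
        unfolding inv by simp
    qed
  qed
qed

end
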